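(* Let $(X,d)$ be a compact metric space, $Y$ a compact subset of $X$, $f\colon X\to X$ a homeomorphism, and $\varphi\colon X\to\mathbb{R}$ a continuous function. Let $\mathfrak{F}$ be a flip-flop family associated to $\varphi$ and $f$ having sojourns along $Y$. Then every plaque $D\in\mathfrak{F}$ contains a point $x_D\in D$ that is controlled at any scale with a long sparse tail with respect to $\varphi$ and $Y$.
   Context: Flip-flop family: a flip-flop family associated to $\varphi$ and $f$ is a family $\mathfrak{F}=\mathfrak{F}^+\sqcup\mathfrak{F}^-$ of non-empty compact subsets of $X$ (called plaques) such that there are $\alpha>0$ and positive numbers $\zeta_n\to0$ with: (1) $\varphi(x)\ge\alpha$ for every $x\in D\in\mathfrak{F}^+$, and $\varphi(x)\le-\alpha$ for every $x\in D\in\mathfrak{F}^-$; (2) for every $D\in\mathfrak{F}$ there are $D^+\in\mathfrak{F}^+$ and $D^-\in\mathfrak{F}^-$ contained in $f(D)$; (3) for every $n>0$ and every $D_0,\dots,D_n\in\mathfrak{F}$ with $D_{i+1}\subset f(D_i)$, one has $d(f^{n-i}(x),f^{n-i}(y))\le\zeta_i\,d(f^n(x),f^n(y))$ for every $i\in\{0,\dots,n\}$ and $x,y\in f^{-n}(D_n)$. Sojourns along $Y$: for every $\delta>0$ there is an integer $N=N_\delta$ such that every $D\in\mathfrak{F}$ contains subsets $\widehat D^+,\widehat D^-$ with: (1) for every $x\in\widehat D^+\cup\widehat D^-$ the orbit segment $\{x,\dots,f^N(x)\}$ is $\delta$-dense in $Y$; (2) $f^N(\widehat D^+)\in\mathfrak{F}^+$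 and $f^N(\widehat D^-)\in\mathfrak{F}^-$; (3) for every $i\in\{0,\dots,N\}$ and every $x,y\in\widehat D^+$ or $x,y\in\widehat D^-$, $d(f^{N-i}(x),f^{N-i}(y))\le\zeta_i\,d(f^N(x),f^N(y))$, with $(\zeta_i)_i$ a sequence as in the definition of flip-flop family. A set is $\delta$-dense in $Y$ if its $\delta$-neighbourhood contains $Y$. Notation: $[a,b]_{\mathbb{N}}=[a,b]\cap\mathbb{N}$, with $0\in\mathbb{N}$. A component of $S\subset\mathbb{N}$ is an interval of integers $[a,b]_{\mathbb{N}}\subset S$ with $a-1,b+1\notin S$. Scale: a sequence $\mathcal{T}=(T_n)_{n\ge0}$ of positive integers such that there are integers $\kappa_n\ge3$ ($n\ge1$) with $T_n=\kappa_nT_{n-1}$ and $\kappa_{n+1}/\kappa_n\to\infty$; moreover $T_0$ (hence every $T_n$) is a multiple of $3$. Controlling sequence: a sequence $\bar\varepsilon=(\varepsilon_n)_n$ of positive numbers converging to $0$ with $\sum_n\varepsilon_n<\infty$ and $\prod_n(1-\varepsilon_n)>0$. $\mathcal{T}$-long $\bar\varepsilon$-sparse tail: a set $R_\infty\subset\mathbb{N}$ such that: (a) every component of $R_\infty$ is of the form $[kT_n,(k+1)T_n-1]_{\mathbb{N}}$ for some $k,n$ (it has size $T_n$). Let $R_n$ be the union of the components of size $T_n$ and $R_{n,\infty}=\bigcup_{i\ge n}R_i$; (b) $0\notin R_\infty$; (c) for every interval $I=[kT_n,(k+1)T_n-1]_{\mathbb{N}}$, $n\ge1$, $k\ge0$,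 not contained in any component of $R_\infty$: $[kT_n,kT_n+\frac{T_n}{3}]\cap R_{n-1}=\emptyset=[((k+1)T_n-1)-\frac{T_n}{3},(k+1)T_n-1]\cap R_{n-1}$ and $0<\frac{\#(R_{n-1}\cap I)}{T_n}<\varepsilon_n$. Controlled point: $x\in X$ is controlled at any scale with a long sparse tail with respect to $\varphi$ and $Y$ if there are a scale $\mathcal{T}$, a controlling sequence $\bar\varepsilon$, a $\mathcal{T}$-long $\bar\varepsilon$-sparse tail $R_\infty$, and decreasing sequences $(\delta_n)_n$, $(\alpha_n)_n$ of positive numbers converging to $0$ such that: (i) for every component $I$ of $R_\infty$ of size $T_n$, the orbit segment $\{f^i(x):i\in I\}$ is $\delta_n$-dense in $Y$; (ii) for every interval $I=[kT_n,(k+1)T_n-1]_{\mathbb{N}}$ with $I\not\subset R_{n+1,\infty}$, one has $\frac1{T_n}\sum_{i\in I}\varphi(f^i(x))\in[-\alpha_n,\alpha_n]$. *)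

theory Defs
  imports "HOL-Analysis.Analysis"
begin

text \<open>
  The ambient space is the whole type; a family of plaques is given by its two parts
  \<open>Fp\<close> (positive) and \<open>Fm\<close> (negative).
\<close>

definition flip_flop_family ::
  "('a::metric_space \<Rightarrow> real) \<Rightarrow> ('a \<Rightarrow> 'a) \<Rightarrow> 'a set set \<Rightarrow> 'a set set \<Rightarrow> bool" where
  "flip_flop_family \<phi> f Fp Fm \<longleftrightarrow>
     Fp \<inter> Fm = {} \<and>
     (\<forall>D\<in>Fp \<union> Fm. compact D \<and> D \<noteq> {}) \<and>
     (\<exists>(\<alpha>::real) (\<zeta>::nat \<Rightarrow> real).
        0 < \<alpha> \<and> (\<forall>n. 0 < \<zeta> n) \<and> \<zeta> \<longlonglongrightarrow> 0 \<and>
        (\<forall>D\<in>Fp. \<forall>x\<in>D. \<phi> x \<ge> \<alpha>) \<and>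
        (\<forall>D\<in>Fm. \<forall>x\<in>D. \<phi> x \<le> - \<alpha>) \<and>
        (\<forall>D\<in>Fp \<union> Fm. (\<exists>D'\<in>Fp. D' \<subseteq> f ` D) \<and> (\<exists>D'\<in>Fm. D' \<subseteq> f ` D)) \<and>
        (\<forall>n>0. \<forall>D::nat \<Rightarrow> 'a set.
           (\<forall>i\<le>n. D i \<in> Fp \<union> Fm) \<and> (\<forall>i<n. D (Suc i) \<subseteq> f ` D i) \<longrightarrow>
           (\<forall>i\<le>n. \<forall>x \<in> (f ^^ n) -` D n. \<forall>y \<in> (f ^^ n) -` D n.
              dist ((f ^^ (n - i)) x) ((f ^^ (n - i)) y)
                \<le> \<zeta> i * dist ((f ^^ n) x) ((f ^^ n) y))))"

definition delta_dense :: "real \<Rightarrow> 'a::metric_space set \<Rightarrow> 'a set \<Rightarrow> bool" where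
  "delta_dense \<delta> S Y \<longleftrightarrow> Y \<subseteq> (\<Union>s\<in>S. ball s \<delta>)"

text \<open>
  The sequence \<open>\<zeta>\<close> is chosen before \<open>\<delta>\<close>. It is not required to be a witness for
  \<^const>\<open>flip_flop_family\<close>; replacing two such sequences by their pointwise maximum
  shows that this makes no difference.
\<close>

definition has_sojourns ::
  "('a::metric_space \<Rightarrow> 'a) \<Rightarrow> 'a set set \<Rightarrow> 'a set set \<Rightarrow> 'a set \<Rightarrow> bool" where
  "has_sojourns f Fp Fm Y \<longleftrightarrow>
     (\<exists>\<zeta>::nat \<Rightarrow> real. (\<forall>n. 0 < \<zeta> n) \<and> \<zeta> \<longlonglongrightarrow> 0 \<and>
       (\<forall>\<delta>>0. \<exists>N::nat. \<forall>D\<in>Fp \<union> Fm. \<exists>Dp Dm.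
          Dp \<subseteq> D \<and> Dm \<subseteq> D \<and>
          (\<forall>x\<in>Dp \<union> Dm. delta_dense \<delta> ((\<lambda>i. (f ^^ i) x) ` {0..N}) Y) \<and>
          (f ^^ N) ` Dp \<in> Fp \<and> (f ^^ N) ` Dm \<in> Fm \<and>
          (\<forall>i\<le>N. \<forall>x y. (x \<in> Dp \<and> y \<in> Dp) \<or> (x \<in> Dm \<and> y \<in> Dm) \<longrightarrow>
             dist ((f ^^ (N - i)) x) ((f ^^ (N - i)) y)
               \<le> \<zeta> i * dist ((f ^^ N) x) ((f ^^ N) y))))"

text \<open>
  The disjunct \<open>a = 0\<close> accounts for truncated subtraction: the predecessor \<open>-1\<close> of \<open>0\<close>
  is never in \<open>S\<close>. Components are non-empty.
\<close>

definition nat_component :: "nat set \<Rightarrow> nat set \<Rightarrow> bool" where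
  "nat_component S I \<longleftrightarrow>
     (\<exists>a b. a \<le> b \<and> I = {a..b} \<and> {a..b} \<subseteq> S \<and> (a = 0 \<or> a - 1 \<notin> S) \<and> b + 1 \<notin> S)"

definition scale :: "(nat \<Rightarrow> nat) \<Rightarrow> bool" where
  "scale T \<longleftrightarrow>
     (\<forall>n. 0 < T n) \<and> 3 dvd T 0 \<and>
     (\<exists>\<kappa>::nat \<Rightarrow> nat.
        (\<forall>n\<ge>1. 3 \<le> \<kappa> n \<and> T n = \<kappa> n * T (n - 1)) \<and>
        filterlim (\<lambda>n. real (\<kappa> (n + 1)) / real (\<kappa> n)) at_top sequentially)"

definition controlling_sequence :: "(nat \<Rightarrow> real) \<Rightarrow> bool" where
  "controlling_sequence \<epsilon> \<longleftrightarrow>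
     (\<forall>n. 0 < \<epsilon> n) \<and> \<epsilon> \<longlonglongrightarrow> 0 \<and> summable \<epsilon> \<and>
     convergent_prod (\<lambda>n. 1 - \<epsilon> n) \<and> 0 < (\<Prod>n. 1 - \<epsilon> n)"

definition block :: "(nat \<Rightarrow> nat) \<Rightarrow> nat \<Rightarrow> nat \<Rightarrow> nat set" where
  "block T n k = {k * T n .. (k + 1) * T n - 1}"

definition tail_level :: "(nat \<Rightarrow> nat) \<Rightarrow> nat set \<Rightarrow> nat \<Rightarrow> nat set" where
  "tail_level T R n = \<Union>{I. nat_component R I \<and> card I = T n}"

definition tail_from :: "(nat \<Rightarrow> nat) \<Rightarrow> nat set \<Rightarrow> nat \<Rightarrow> nat set" where
  "tail_from T R n = (\<Union>i\<in>{n..}. tail_level T R i)"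

text \<open>
  For a scale \<open>T\<close> all \<open>T n\<close> are positive multiples of \<open>3\<close>, so the divisions by \<open>3\<close> are
  exact and the subtractions below and in \<^const>\<open>block\<close> are not truncated.
\<close>

definition long_sparse_tail :: "(nat \<Rightarrow> nat) \<Rightarrow> (nat \<Rightarrow> real) \<Rightarrow> nat set \<Rightarrow> bool" where
  "long_sparse_tail T \<epsilon> R \<longleftrightarrow>
     (\<forall>I. nat_component R I \<longrightarrow> (\<exists>n k. I = block T n k)) \<and>
     0 \<notin> R \<and>
     (\<forall>n\<ge>1. \<forall>k. (\<nexists>J. nat_component R J \<and> block T n k \<subseteq> J) \<longrightarrow>
        {k * T n .. k * T n + T n div 3} \<inter> tail_level T R (n - 1) = {} \<and>
        {(k + 1) * T n - 1 - T n div 3 .. (k + 1) * T n - 1} \<inter> tail_level T R (n - 1) = {} \<and>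
        0 < real (card (tail_level T R (n - 1) \<inter> block T n k)) / real (T n) \<and>
        real (card (tail_level T R (n - 1) \<inter> block T n k)) / real (T n) < \<epsilon> n)"

definition controlled_at_any_scale ::
  "('a::metric_space \<Rightarrow> 'a) \<Rightarrow> ('a \<Rightarrow> real) \<Rightarrow> 'a set \<Rightarrow> 'a \<Rightarrow> bool" where
  "controlled_at_any_scale f \<phi> Y x \<longleftrightarrow>
     (\<exists>(T::nat \<Rightarrow> nat) (\<epsilon>::nat \<Rightarrow> real) (R::nat set) (\<delta>::nat \<Rightarrow> real) (\<alpha>::nat \<Rightarrow> real).
        scale T \<and> controlling_sequence \<epsilon> \<and> long_sparse_tail T \<epsilon> R \<and>
        decseq \<delta> \<and> (\<forall>n. 0 < \<delta> n) \<and> \<delta> \<longlonglongrightarrow> 0 \<and>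
        decseq \<alpha> \<and> (\<forall>n. 0 < \<alpha> n) \<and> \<alpha> \<longlonglongrightarrow> 0 \<and>
        (\<forall>n I. nat_component R I \<and> card I = T n \<longrightarrow>
           delta_dense (\<delta> n) ((\<lambda>i. (f ^^ i) x) ` I) Y) \<and>
        (\<forall>n k. \<not> block T n k \<subseteq> tail_from T R (n + 1) \<longrightarrow>
           (\<Sum>i\<in>block T n k. \<phi> ((f ^^ i) x)) / real (T n) \<in> {- \<alpha> n .. \<alpha> n}))"

end

theory Submission
  imports Defs
begin

text \<open>
  The tail is fixed by a deterministic rule: inside each block of length \<open>T (n + 1)\<close> the middle block
  of length \<open>T n\<close> is marked, and the tail is the union of all marked blocks. Its components are the
  maximal marked blocks (lemmas \<open>component_block\<close>, \<open>component_is_block\<close>), and a block of length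
  \<open>T (n + 1)\<close> that is not contained in a component contains exactly one component of size \<open>T n\<close>. This
  makes the tail long and sparse as soon as the ratios \<open>T (n + 1) / T n\<close> grow fast enough.

  Birkhoff sums are controlled by feedback. Suppose that, starting in any plaque, one can choose the
  sign of the sum of \<open>\<phi>\<close> over the next \<open>L\<close> steps, with averages of absolute value in \<open>[b, B]\<close>, and
  that over these \<open>L\<close> steps distances are at least doubled. At the start this holds by staying in
  plaques of one sign. Concatenate \<open>\<kappa>\<close> such windows and give each window the sign that moves the
  total sum towards a target. The sum is known at one point of the current piece of plaque only, but
  by contraction and uniform continuity of \<open>\<phi>\<close> it varies over the piece by \<open>o(\<kappa> L)\<close>. So for large
  \<open>\<kappa>\<close> either of the averages \<open>b / 2\<close> and \<open>- b / 2\<close> is attained up to an error of at most \<open>b / 4\<close>, and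
  the hypothesis holds again for \<open>\<kappa> L\<close> with \<open>[b / 4, 3 b / 4]\<close> (lemmas \<open>greedy_run\<close>,
  \<open>steerable_concat\<close>). A prefix of bounded length does not disturb this. In a marked block the
  prefix contains a sojourn, which makes the orbit segment \<open>\<delta>\<close>-dense in \<open>Y\<close>.

  Iterating this construction with larger and larger ratios yields block lengths and, for each \<open>n\<close>
  and each plaque, a point of the plaque that satisfies all requirements up to time \<open>T n\<close>
  (\<open>steering_hierarchy\<close>). A limit point of these points is controlled at any scale
  (\<open>controlled_point\<close>).
\<close>

section \<open>Chains of contracted distances\<close>

text \<open>
  \<open>u t\<close> stands for the distance at time \<open>t\<close> between the orbits of two points. The time interval
  \<open>[0, p + q L]\<close> consists of a prefix of length \<open>p\<close> and of \<open>q\<close> windows of length \<open>L\<close>. Inside the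
  prefix and inside each window the distance never exceeds \<open>Z\<close> times its final value there, and
  each window at least doubles the distance between its two ends.
\<close>
definition contracting_chain :: "real \<Rightarrow> nat \<Rightarrow> nat \<Rightarrow> nat \<Rightarrow> (nat \<Rightarrow> real) \<Rightarrow> bool" where
  "contracting_chain Z p L q u \<longleftrightarrow>
     (\<forall>t\<le>p. u t \<le> Z * u p) \<and>
     (\<forall>r<q. u (p + r * L) \<le> u (p + Suc r * L) / 2 \<and>
            (\<forall>i\<le>L. u (p + r * L + i) \<le> Z * u (p + Suc r * L)))"

lemma contracting_chain_endpoints:
  assumes "contracting_chain Z p L q u" "k \<le> q"
  shows "u (p + (q - k) * L) * 2 ^ k \<le> u (p + q * L)"
  using assms(2)
proof (induction k)
  case (Suc k)
  have "q - Suc k < q" "Suc (q - Suc k) = q - k"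
    using Suc.prems by auto
  then have "u (p + (q - Suc k) * L) \<le> u (p + (q - k) * L) / 2"
    using assms(1) unfolding contracting_chain_def by metis
  then have "u (p + (q - Suc k) * L) * 2 ^ Suc k \<le> u (p + (q - k) * L) * 2 ^ k"
    using mult_right_mono[of "u (p + (q - Suc k) * L) * 2" "u (p + (q - k) * L)" "2 ^ k"]
    by (simp add: mult.assoc)
  also have "\<dots> \<le> u (p + q * L)"
    using Suc by simp
  finally show ?case .
qed simp

text \<open>
  The losses \<open>Z\<close> of different windows do not multiply, because the factor between the ends of a
  window is \<open>1 / 2\<close> without any constant.
\<close>
lemma contracting_chain_bound:
  assumes chain: "contracting_chain Z p L q u" and "1 \<le> Z" and nonneg: "\<And>t. 0 \<le> u t"
    and "0 < L" and "r \<le> q" and "t \<le> p + r * L"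
  shows "u t * 2 ^ (q - r) \<le> Z * u (p + q * L)"
proof -
  obtain s where s: "s \<le> r" "u t \<le> Z * u (p + s * L)"
  proof (cases "t \<le> p")
    case True
    then have "u t \<le> Z * u (p + 0 * L)"
      using chain by (auto simp: contracting_chain_def)
    then show ?thesis using that by blast
  next
    case False
    \<comment> \<open>\<open>t\<close> lies in the window \<open>s\<close>; the common end of two windows is counted in the earlier one.\<close>
    define s where "s = (t - p - 1) div L"
    define i where "i = t - p - s * L"
    have "s * L \<le> t - p - 1" "t - p - 1 < Suc s * L"
      using \<open>0 < L\<close> unfolding s_def
      by (auto simp: dividend_less_times_div)
        (metis add.commute dividend_less_div_times)
    moreover from this have "s * L < r * L"
      using False assms(6) by linarith
    then have "s < r" by simp
    ultimately have "i \<le> L" "t = p + s * L + i" "s < q"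
      using False \<open>r \<le> q\<close> by (auto simp: i_def)
    then have "u t \<le> Z * u (p + Suc s * L)"
      using chain unfolding contracting_chain_def by metis
    then show ?thesis using that \<open>s < r\<close> Suc_leI by blast
  qed
  have "u t * 2 ^ (q - r) \<le> u t * 2 ^ (q - s)"
    using s(1) nonneg[of t] by (intro mult_left_mono power_increasing) auto
  also have "\<dots> \<le> Z * (u (p + s * L) * 2 ^ (q - s))"
    using mult_right_mono[OF s(2), of "2 ^ (q - s)"] by (simp add: mult.assoc)
  also have "\<dots> \<le> Z * u (p + q * L)"
    using contracting_chain_endpoints[OF chain, of "q - s"] s(1) \<open>r \<le> q\<close> \<open>1 \<le> Z\<close>
    by (intro mult_left_mono) auto
  finally show ?thesis .
qed

section \<open>Birkhoff sums\<close>

text \<open>The sum of \<open>\<phi>\<close> over the first \<open>n\<close> points of the orbit of \<open>x\<close>.\<close>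
definition birkhoff_sum :: "('a \<Rightarrow> 'a) \<Rightarrow> ('a \<Rightarrow> real) \<Rightarrow> nat \<Rightarrow> 'a \<Rightarrow> real" where
  "birkhoff_sum f \<phi> n x = (\<Sum>i<n. \<phi> ((f ^^ i) x))"

lemma birkhoff_sum_add:
  "birkhoff_sum f \<phi> (m + n) x = birkhoff_sum f \<phi> m x + birkhoff_sum f \<phi> n ((f ^^ m) x)"
proof (induction n)
  case (Suc n)
  have "(f ^^ (m + n)) x = (f ^^ n) ((f ^^ m) x)"
    by (metis add.commute comp_apply funpow_add)
  with Suc show ?case by (simp add: birkhoff_sum_def)
qed (simp add: birkhoff_sum_def)

section \<open>Steering Birkhoff sums by feedback\<close>

text \<open>
  \<open>F\<close> is the family of all plaques, \<open>C\<close> bounds \<open>\<phi>\<close>, \<open>\<Delta>\<close> strictly bounds all distances, and \<open>Z\<close> is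
  the constant in the distance estimates.
\<close>
locale plaque_dynamics =
  fixes f :: "'a::metric_space \<Rightarrow> 'a" and \<phi> :: "'a \<Rightarrow> real" and F :: "'a set set"
    and Z C \<Delta> :: real
  assumes Z_ge_1: "1 \<le> Z"
    and C_pos: "0 < C" and \<phi>_bound: "\<And>x. \<bar>\<phi> x\<bar> \<le> C"
    and diam: "\<And>x y :: 'a. dist x y < \<Delta>"
    and \<phi>_unif: "uniformly_continuous_on UNIV \<phi>"
    and plaque_nonempty: "\<And>D. D \<in> F \<Longrightarrow> D \<noteq> {}"
begin

abbreviation S :: "nat \<Rightarrow> 'a \<Rightarrow> real" where
  "S \<equiv> birkhoff_sum f \<phi>"

text \<open>
  A piece \<open>A\<close> of the plaque \<open>D\<close> that is a full plaque after \<open>L\<close> steps, and along which distances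
  are controlled by those at time \<open>L\<close>.
\<close>
definition segment :: "nat \<Rightarrow> 'a set \<Rightarrow> 'a set \<Rightarrow> bool" where
  "segment L D A \<longleftrightarrow> A \<subseteq> D \<and> (f ^^ L) ` A \<in> F \<and>
     (\<forall>x\<in>A. \<forall>y\<in>A. \<forall>i\<le>L. dist ((f ^^ i) x) ((f ^^ i) y) \<le> Z * dist ((f ^^ L) x) ((f ^^ L) y))"

text \<open>
  From every plaque one can follow, for \<open>L\<close> steps, a piece of it on which \<open>P\<close> holds and on which the
  Birkhoff sum has a prescribed sign \<open>\<sigma>\<close>, with average of absolute value in \<open>[b, B]\<close>. The piece
  reaches a full plaque at time \<open>L\<close>, and its points are then at least twice as far apart as
  initially.
\<close>
definition steerable :: "nat \<Rightarrow> ('a \<Rightarrow> bool) \<Rightarrow> real \<Rightarrow> real \<Rightarrow> bool" where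
  "steerable L P b B \<longleftrightarrow>
     (\<forall>D\<in>F. \<forall>\<sigma>\<in>{-1, 1}. \<exists>A. segment L D A \<and>
        (\<forall>x\<in>A. \<forall>y\<in>A. dist x y \<le> dist ((f ^^ L) x) ((f ^^ L) y) / 2) \<and>
        (\<forall>x\<in>A. P x \<and> b * L \<le> \<sigma> * S L x \<and> \<sigma> * S L x \<le> B * L))"

lemma steerable_weaken:
  assumes "steerable L P b B" "0 < b" "B \<le> B'"
    and "\<And>x. P x \<Longrightarrow> \<bar>S L x\<bar> \<le> B * L \<Longrightarrow> P' x"
  shows "steerable L P' b B'"
  unfolding steerable_def
proof (intro ballI)
  fix D and \<sigma> :: real assume D: "D \<in> F" and \<sigma>: "\<sigma> \<in> {-1, 1}"
  then obtain A where A: "segment L D A"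
      "\<forall>x\<in>A. \<forall>y\<in>A. dist x y \<le> dist ((f ^^ L) x) ((f ^^ L) y) / 2"
      "\<forall>x\<in>A. P x \<and> b * L \<le> \<sigma> * S L x \<and> \<sigma> * S L x \<le> B * L"
    using assms(1) unfolding steerable_def by meson
  have "P' x \<and> b * L \<le> \<sigma> * S L x \<and> \<sigma> * S L x \<le> B' * L" if "x \<in> A" for x
  proof -
    have *: "P x" "b * L \<le> \<sigma> * S L x" "\<sigma> * S L x \<le> B * L" using A(3) that by auto
    moreover have "0 \<le> b * L" using assms(2) by simp
    ultimately have "\<bar>S L x\<bar> \<le> B * L" using \<sigma> by auto
    moreover have "B * L \<le> B' * L" using assms(3) by (simp add: mult_right_mono)
    ultimately show ?thesis using * assms(4) by fastforce
  qed
  with A show "\<exists>A. segment L D A \<and>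
        (\<forall>x\<in>A. \<forall>y\<in>A. dist x y \<le> dist ((f ^^ L) x) ((f ^^ L) y) / 2) \<and>
        (\<forall>x\<in>A. P' x \<and> b * L \<le> \<sigma> * S L x \<and> \<sigma> * S L x \<le> B' * L)"
    by blast
qed

lemma birkhoff_bound: "\<bar>S n x\<bar> \<le> C * n"
proof -
  have "\<bar>S n x\<bar> \<le> (\<Sum>i<n. \<bar>\<phi> ((f ^^ i) x)\<bar>)"
    unfolding birkhoff_sum_def by (rule sum_abs)
  also have "\<dots> \<le> of_nat (card {..<n}) * C"
    using \<phi>_bound by (intro sum_bounded_above) auto
  finally show ?thesis by (simp add: mult.commute)
qed

text \<open>
  All terms of the difference of the two sums are at most \<open>\<eta>\<close>, except for the last \<open>p + Q L\<close> ones: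
  at all earlier times at least \<open>Q\<close> windows are still to come, so the orbits are closer than \<open>d\<close>.
\<close>
lemma birkhoff_distortion:
  assumes chain: "contracting_chain Z p L q (\<lambda>t. dist ((f ^^ t) x) ((f ^^ t) y))"
    and "0 < L"
    and d: "\<And>x y. dist x y < d \<Longrightarrow> \<bar>\<phi> x - \<phi> y\<bar> \<le> \<eta>" and "0 \<le> \<eta>"
    and Q: "Z * \<Delta> < d * 2 ^ Q"
  shows "\<bar>S (p + q * L) x - S (p + q * L) y\<bar> \<le> \<eta> * (p + q * L) + 2 * C * (p + Q * L)"
proof -
  let ?n = "p + q * L" and ?h = "p + Q * L"
  let ?g = "\<lambda>t. \<bar>\<phi> ((f ^^ t) x) - \<phi> ((f ^^ t) y)\<bar>"
  \<comment> \<open>The truncated difference \<open>?n - ?h\<close> vanishes if \<open>q \<le> Q\<close>, so nothing is claimed then.\<close>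
  have small: "?g t \<le> \<eta>" if "t < ?n - ?h" for t
  proof -
    have less: "t + Q * L < q * L" using that by simp
    then have "Q < q" by (metis add_lessD1 add.commute mult_less_cancel2)
    have "t \<le> p + (q - Q) * L" using less by (simp add: diff_mult_distrib)
    then have "dist ((f ^^ t) x) ((f ^^ t) y) * 2 ^ (q - (q - Q)) \<le>
        Z * dist ((f ^^ ?n) x) ((f ^^ ?n) y)"
      using contracting_chain_bound[OF chain Z_ge_1 _ \<open>0 < L\<close>, of "q - Q" t] by simp
    also have "\<dots> \<le> Z * \<Delta>"
      using Z_ge_1 diam by (intro mult_left_mono) (auto simp: less_imp_le)
    also note Q
    finally have "dist ((f ^^ t) x) ((f ^^ t) y) * 2 ^ Q < d * 2 ^ Q" using \<open>Q < q\<close> by simp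
    then show ?thesis using d by simp
  qed
  have big: "?g t \<le> 2 * C" for t
    using \<phi>_bound[of "(f ^^ t) x"] \<phi>_bound[of "(f ^^ t) y"] by linarith
  have "\<bar>S ?n x - S ?n y\<bar> \<le> (\<Sum>t<?n. ?g t)"
    unfolding birkhoff_sum_def sum_subtractf[symmetric] by (rule sum_abs)
  also have "\<dots> = (\<Sum>t<?n - ?h. ?g t) + (\<Sum>t=?n - ?h..<?n. ?g t)"
    unfolding lessThan_atLeast0 by (rule sum.atLeastLessThan_concat[symmetric]) auto
  also have "\<dots> \<le> real (?n - ?h) * \<eta> + real (card {?n - ?h..<?n}) * (2 * C)"
    using small big
    by (intro add_mono order_trans[OF sum_bounded_above]) auto
  also have "\<dots> \<le> ?n * \<eta> + ?h * (2 * C)"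
    using \<open>0 \<le> \<eta>\<close> C_pos by (intro add_mono mult_right_mono) (auto simp del: of_nat_add of_nat_mult)
  finally show ?thesis by (simp add: mult.commute)
qed

text \<open>
  The feedback argument. Each new window gets the sign that moves the Birkhoff sum, evaluated at
  one point of the current piece, towards the target \<open>W\<close>. Since the sum varies by at most \<open>E\<close> on
  the piece, the bound on the deviation from \<open>W\<close> decreases by \<open>b L\<close> with each window, down to the
  distortion \<open>E\<close> plus one step \<open>B L\<close>.
\<close>
lemma greedy_run:
  assumes "0 < b" "0 < L"
    and steer: "\<And>q. steerable L (P q) b B"
    and A0: "segment p D A0"
    and E: "\<And>q x y. q < m \<Longrightarrow> contracting_chain Z p L q (\<lambda>t. dist ((f ^^ t) x) ((f ^^ t) y))
        \<Longrightarrow> \<bar>S (p + q * L) x - S (p + q * L) y\<bar> \<le> E"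
    and "q \<le> m"
  shows "\<exists>A\<subseteq>A0. (f ^^ (p + q * L)) ` A \<in> F \<and>
      (\<forall>x\<in>A. \<forall>y\<in>A. contracting_chain Z p L q (\<lambda>t. dist ((f ^^ t) x) ((f ^^ t) y))) \<and>
      (\<forall>x\<in>A. (\<forall>r<q. P r ((f ^^ (p + r * L)) x)) \<and>
        \<bar>S (p + q * L) x - W\<bar> \<le> max (\<bar>W\<bar> + C * p - q * (b * L)) (E + B * L))"
  using \<open>q \<le> m\<close>
proof (induction q)
  case 0
  have "\<bar>S p x - W\<bar> \<le> max (\<bar>W\<bar> + C * p) (E + B * L)" for x
    using birkhoff_bound[of p x] by linarith
  then show ?case
    using A0 by (intro exI[of _ A0]) (auto simp: segment_def contracting_chain_def)
next
  case (Suc q)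
  let ?n = "p + q * L"
  have n': "p + Suc q * L = L + ?n" by simp
  obtain A where "A \<subseteq> A0" and A: "(f ^^ ?n) ` A \<in> F"
    and chain: "\<forall>x\<in>A. \<forall>y\<in>A. contracting_chain Z p L q (\<lambda>t. dist ((f ^^ t) x) ((f ^^ t) y))"
    and cond: "\<forall>x\<in>A. (\<forall>r<q. P r ((f ^^ (p + r * L)) x)) \<and>
        \<bar>S ?n x - W\<bar> \<le> max (\<bar>W\<bar> + C * p - q * (b * L)) (E + B * L)"
    using Suc by (auto simp: Suc_le_eq dest: less_imp_le)
  obtain x0 where x0: "x0 \<in> A" using plaque_nonempty[OF A] by blast
  \<comment> \<open>Steer upwards if the sum at \<open>x0\<close> is below the target, and downwards otherwise.\<close>
  define \<sigma> :: real where "\<sigma> = (if S ?n x0 < W then 1 else -1)"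
  have "\<sigma> \<in> {-1, 1}" by (auto simp: \<sigma>_def)
  then obtain A1 where A1: "segment L ((f ^^ ?n) ` A) A1"
      "\<forall>x\<in>A1. \<forall>y\<in>A1. dist x y \<le> dist ((f ^^ L) x) ((f ^^ L) y) / 2"
      "\<forall>x\<in>A1. P q x \<and> b * L \<le> \<sigma> * S L x \<and> \<sigma> * S L x \<le> B * L"
    using steer A unfolding steerable_def by meson
  define A' where "A' = {x \<in> A. (f ^^ ?n) x \<in> A1}"
  have "(f ^^ ?n) ` A' = A1"
    using A1(1) by (auto simp: A'_def segment_def)
  then have "(f ^^ (L + ?n)) ` A' = (f ^^ L) ` A1"
    by (simp only: funpow_add image_comp[symmetric])
  then have img: "(f ^^ (p + Suc q * L)) ` A' \<in> F"
    using A1(1) unfolding n' by (simp add: segment_def)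
  have chain': "contracting_chain Z p L (Suc q) (\<lambda>t. dist ((f ^^ t) x) ((f ^^ t) y))"
    if "x \<in> A'" "y \<in> A'" for x y
  proof -
    have "x \<in> A" "y \<in> A" and *: "(f ^^ ?n) x \<in> A1" "(f ^^ ?n) y \<in> A1"
      using that by (auto simp: A'_def)
    have iter: "(f ^^ i) ((f ^^ ?n) z) = (f ^^ (?n + i)) z" for i z
      by (simp add: funpow_add flip: add.commute[of i])
    have "\<forall>i\<le>L. dist ((f ^^ (?n + i)) x) ((f ^^ (?n + i)) y)
        \<le> Z * dist ((f ^^ (?n + L)) x) ((f ^^ (?n + L)) y)"
      using A1(1) * unfolding segment_def iter[symmetric] by blast
    moreover have "dist ((f ^^ ?n) x) ((f ^^ ?n) y) \<le> dist ((f ^^ (?n + L)) x) ((f ^^ (?n + L)) y) / 2"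
      using A1(2) * unfolding iter[symmetric] by blast
    moreover have "?n + L = p + Suc q * L" by simp
    ultimately show ?thesis
      using chain \<open>x \<in> A\<close> \<open>y \<in> A\<close> unfolding contracting_chain_def by (auto simp: less_Suc_eq)
  qed
  have cond': "(\<forall>r<Suc q. P r ((f ^^ (p + r * L)) x)) \<and>
      \<bar>S (p + Suc q * L) x - W\<bar> \<le> max (\<bar>W\<bar> + C * p - Suc q * (b * L)) (E + B * L)"
    if "x \<in> A'" for x
  proof -
    have "x \<in> A" and *: "(f ^^ ?n) x \<in> A1" using that by (auto simp: A'_def)
    define s where "s = S ?n x"
    define v where "v = S L ((f ^^ ?n) x)"
    have sv: "S (p + Suc q * L) x = s + v"
      using birkhoff_sum_add[of f \<phi> ?n L x] by (simp add: s_def v_def algebra_simps)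
    have v: "b * L \<le> \<sigma> * v" "\<sigma> * v \<le> B * L" using A1(3) * by (auto simp: v_def)
    have s: "\<bar>s - W\<bar> \<le> max (\<bar>W\<bar> + C * p - q * (b * L)) (E + B * L)"
      using cond \<open>x \<in> A\<close> by (auto simp: s_def)
    have dist: "\<bar>s - S ?n x0\<bar> \<le> E"
      unfolding s_def using E chain \<open>x \<in> A\<close> x0 Suc.prems by auto
    have bL: "0 \<le> b * L" using assms(1) by simp
    have eq: "\<bar>W\<bar> + C * p - Suc q * (b * L) = \<bar>W\<bar> + C * p - q * (b * L) - b * L"
      by (simp add: algebra_simps)
    have "\<bar>s + v - W\<bar> \<le> max (\<bar>W\<bar> + C * p - Suc q * (b * L)) (E + B * L)"
      unfolding eq using v s dist bL unfolding \<sigma>_def by (auto split: if_splits)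
    moreover have "\<forall>r<Suc q. P r ((f ^^ (p + r * L)) x)"
      using cond \<open>x \<in> A\<close> A1(3) * by (auto simp: less_Suc_eq)
    ultimately show ?thesis unfolding sv by blast
  qed
  show ?case
    using \<open>A \<subseteq> A0\<close> img chain' cond' by (intro exI[of _ A']) (auto simp: A'_def)
qed

text \<open>
  \<open>R\<close> holds at the start, and \<open>P q\<close> at the start of the window \<open>q\<close>, for \<open>m\<close> windows of length \<open>L\<close>
  that follow a prefix of length \<open>p\<close>.
\<close>
definition itinerary :: "nat \<Rightarrow> nat \<Rightarrow> nat \<Rightarrow> ('a \<Rightarrow> bool) \<Rightarrow> (nat \<Rightarrow> 'a \<Rightarrow> bool) \<Rightarrow> 'a \<Rightarrow> bool" where
  "itinerary p L m R P x \<longleftrightarrow> R x \<and> (\<forall>q<m. P q ((f ^^ (p + q * L)) x))"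

text \<open>
  Many steerable windows, even after a prefix without sign control, form a steerable window with
  averages of absolute value in \<open>[b / 4, 3 b / 4]\<close>. The requirements may vary with the window, but
  the number \<open>\<kappa>0\<close> does not depend on them. The target is an average of \<open>\<sigma> b / 2\<close>; the distortion
  and the last step cost at most \<open>b \<kappa> L / 4\<close>, and the prefix only delays the approach to the target.
\<close>
lemma steerable_concat:
  assumes "0 < b" "0 < L"
  shows "\<exists>\<kappa>0. \<forall>\<kappa>\<ge>\<kappa>0. \<forall>P R. (\<forall>q. steerable L (P q) b B) \<longrightarrow>
      (\<forall>D\<in>F. \<exists>A. segment (p * L) D A \<and> (\<forall>x\<in>A. R x)) \<longrightarrow>
      steerable (\<kappa> * L) (itinerary (p * L) L (\<kappa> - p) R P) (b / 4) (3 * b / 4)"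
proof -
  obtain d where "0 < d" and d: "\<And>x y. dist x y < d \<Longrightarrow> \<bar>\<phi> x - \<phi> y\<bar> \<le> b / 8"
    using \<phi>_unif \<open>0 < b\<close> unfolding uniformly_continuous_on_def dist_real_def
    by (metis UNIV_I dist_commute less_imp_le zero_less_divide_iff zero_less_numeral)
  \<comment> \<open>After \<open>Q\<close> halvings any distance \<open>Z * \<Delta>\<close> is below \<open>d\<close>; \<open>Q1\<close> halvings absorb the factor \<open>2 * Z\<close>.\<close>
  obtain Q where "Z * \<Delta> / d < 2 ^ Q" using real_arch_pow[of 2] by auto
  then have Q: "Z * \<Delta> < d * 2 ^ Q" using \<open>0 < d\<close> by (simp add: field_simps)
  obtain Q1 where Q1: "2 * Z < 2 ^ Q1" using real_arch_pow[of 2] by auto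
  \<comment> \<open>If \<open>\<kappa> \<ge> k1\<close>, the windows after the prefix suffice to reach the target. If \<open>\<kappa> \<ge> k2\<close>, the
    distortion and one step together are at most \<open>b / 4 * (\<kappa> * L)\<close>.\<close>
  obtain k1 :: nat where k1: "p * (C + b) / (b / 2) < k1" using reals_Archimedean2 by blast
  obtain k2 :: nat where k2: "(2 * C * (p + Q) + B) / (b / 8) < k2" using reals_Archimedean2 by blast
  have "steerable (\<kappa> * L) (itinerary (p * L) L (\<kappa> - p) R P) (b / 4) (3 * b / 4)"
    if \<kappa>: "max (p + Q1) (max k1 k2) \<le> \<kappa>" and steer: "\<forall>q. steerable L (P q) b B"
      and pre: "\<forall>D\<in>F. \<exists>A. segment (p * L) D A \<and> (\<forall>x\<in>A. R x)" for \<kappa> P R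
    unfolding steerable_def
  proof (intro ballI)
    fix D and \<sigma> :: real assume D: "D \<in> F" and \<sigma>: "\<sigma> \<in> {-1, 1}"
    obtain A0 where A0: "segment (p * L) D A0" "\<forall>x\<in>A0. R x" using pre D by blast
    define W where "W = \<sigma> * (b / 2 * (\<kappa> * L))"
    define E where "E = b / 8 * (\<kappa> * L) + 2 * C * ((p + Q) * L)"
    let ?q = "\<kappa> - p"
    have len: "p * L + ?q * L = \<kappa> * L" using \<kappa> by (simp flip: add_mult_distrib)
    have E: "\<bar>S (p * L + q * L) x - S (p * L + q * L) y\<bar> \<le> E"
      if "q < ?q" "contracting_chain Z (p * L) L q (\<lambda>t. dist ((f ^^ t) x) ((f ^^ t) y))" for q x y
    proof -
      have "\<bar>S (p * L + q * L) x - S (p * L + q * L) y\<bar>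
          \<le> b / 8 * (p * L + q * L) + 2 * C * (p * L + Q * L)"
        using birkhoff_distortion[OF that(2) \<open>0 < L\<close> d _ Q] \<open>0 < b\<close> by simp
      also have "b / 8 * (p * L + q * L) \<le> b / 8 * (\<kappa> * L)"
      proof -
        have "p + q \<le> \<kappa>" using that(1) by simp
        then have "p * L + q * L \<le> \<kappa> * L" unfolding add_mult_distrib[symmetric] by simp
        then have "real (p * L + q * L) \<le> real (\<kappa> * L)" by linarith
        then show ?thesis using \<open>0 < b\<close> by simp
      qed
      finally show ?thesis by (simp add: E_def algebra_simps)
    qed
    obtain A where "A \<subseteq> A0" and A: "(f ^^ (p * L + ?q * L)) ` A \<in> F"
      and chain: "\<forall>x\<in>A. \<forall>y\<in>A. contracting_chain Z (p * L) L ?q (\<lambda>t. dist ((f ^^ t) x) ((f ^^ t) y))"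
      and cond: "\<forall>x\<in>A. (\<forall>r<?q. P r ((f ^^ (p * L + r * L)) x)) \<and>
        \<bar>S (p * L + ?q * L) x - W\<bar> \<le> max (\<bar>W\<bar> + C * real (p * L) - ?q * (b * L)) (E + B * L)"
      using greedy_run[of b L P B "p * L" D A0 ?q E ?q W] assms steer A0 E by auto
    have \<kappa>1: "p * (C + b) \<le> \<kappa> * (b / 2)" and \<kappa>2: "2 * C * (p + Q) + B \<le> \<kappa> * (b / 8)"
    proof -
      have "p * (C + b) / (b / 2) \<le> \<kappa>" "(2 * C * (p + Q) + B) / (b / 8) \<le> \<kappa>"
        using k1 k2 \<kappa> by linarith+
      then show "p * (C + b) \<le> \<kappa> * (b / 2)" "2 * C * (p + Q) + B \<le> \<kappa> * (b / 8)"
        using \<open>0 < b\<close> by (simp_all add: field_simps)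
    qed
    have W: "\<bar>W\<bar> + C * real (p * L) - ?q * (b * L) \<le> 0"
    proof -
      have "\<bar>W\<bar> = b / 2 * (\<kappa> * L)" using \<sigma> \<open>0 < b\<close> by (auto simp: W_def abs_mult)
      then have "\<bar>W\<bar> + C * real (p * L) - ?q * (b * L) = L * (p * (C + b) - \<kappa> * (b / 2))"
        using \<kappa> by (simp add: of_nat_diff algebra_simps)
      then show ?thesis using \<kappa>1 by (simp add: mult_nonneg_nonpos)
    qed
    have EB: "E + B * L \<le> b / 4 * (\<kappa> * L)"
    proof -
      have "E + B * L = b / 8 * (\<kappa> * L) + (2 * C * (p + Q) + B) * L"
        by (simp add: E_def algebra_simps)
      also have "\<dots> \<le> b / 8 * (\<kappa> * L) + \<kappa> * (b / 8) * L"
        using mult_right_mono[OF \<kappa>2, of "real L"] by linarith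
      finally show ?thesis by (simp add: algebra_simps)
    qed
    have "0 \<le> b / 4 * (\<kappa> * L)" using \<open>0 < b\<close> by simp
    then have dev: "\<bar>S (\<kappa> * L) x - W\<bar> \<le> b / 4 * (\<kappa> * L)" if "x \<in> A" for x
      using cond[rule_format, OF that] W EB unfolding len by linarith
    have sum: "b / 4 * real (\<kappa> * L) \<le> \<sigma> * S (\<kappa> * L) x \<and> \<sigma> * S (\<kappa> * L) x \<le> 3 * b / 4 * real (\<kappa> * L)"
      if "x \<in> A" for x
    proof -
      define c where "c = b / 4 * (\<kappa> * L)"
      have "W = \<sigma> * (2 * c)" "b / 4 * real (\<kappa> * L) = c" "3 * b / 4 * real (\<kappa> * L) = 3 * c"
        by (simp_all add: W_def c_def)
      with dev[OF that] \<sigma> show ?thesis by (auto simp: abs_le_iff)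
    qed
    have seg: "segment (\<kappa> * L) D A"
      unfolding segment_def
    proof (intro conjI ballI allI impI)
      show "A \<subseteq> D" using \<open>A \<subseteq> A0\<close> A0(1) by (auto simp: segment_def)
      show "(f ^^ (\<kappa> * L)) ` A \<in> F" using A unfolding len .
      fix x y i assume "x \<in> A" "y \<in> A" "i \<le> \<kappa> * L"
      then show "dist ((f ^^ i) x) ((f ^^ i) y) \<le> Z * dist ((f ^^ (\<kappa> * L)) x) ((f ^^ (\<kappa> * L)) y)"
        using contracting_chain_bound[OF chain[rule_format, of x y] Z_ge_1 _ \<open>0 < L\<close>, of ?q i]
        unfolding len by simp
    qed
    have half: "dist x y \<le> dist ((f ^^ (\<kappa> * L)) x) ((f ^^ (\<kappa> * L)) y) / 2"
      if "x \<in> A" "y \<in> A" for x y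
    proof -
      have "dist x y * (2 * Z) \<le> dist x y * 2 ^ ?q"
      proof (rule mult_left_mono)
        have "(2::real) ^ Q1 \<le> 2 ^ ?q" using \<kappa> by (intro power_increasing) auto
        then show "2 * Z \<le> 2 ^ ?q" using Q1 by linarith
      qed simp
      also have "\<dots> \<le> Z * dist ((f ^^ (\<kappa> * L)) x) ((f ^^ (\<kappa> * L)) y)"
        using contracting_chain_bound[OF chain[rule_format, OF that] Z_ge_1 _ \<open>0 < L\<close>, of 0 0]
        unfolding len by simp
      finally show ?thesis using Z_ge_1 by (simp add: mult.left_commute mult.commute)
    qed
    show "\<exists>A. segment (\<kappa> * L) D A \<and>
        (\<forall>x\<in>A. \<forall>y\<in>A. dist x y \<le> dist ((f ^^ (\<kappa> * L)) x) ((f ^^ (\<kappa> * L)) y) / 2) \<and>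
        (\<forall>x\<in>A. itinerary (p * L) L (\<kappa> - p) R P x \<and>
           b / 4 * real (\<kappa> * L) \<le> \<sigma> * S (\<kappa> * L) x \<and> \<sigma> * S (\<kappa> * L) x \<le> 3 * b / 4 * real (\<kappa> * L))"
      using seg half sum cond A0(2) \<open>A \<subseteq> A0\<close> unfolding itinerary_def
      by (intro exI[of _ A]) blast
  qed
  then show ?thesis by blast
qed

end

section \<open>Flip-flop families with sojourns\<close>

lemma delta_dense_mono: "delta_dense \<delta> A Y \<Longrightarrow> A \<subseteq> B \<Longrightarrow> delta_dense \<delta> B Y"
  unfolding delta_dense_def by blast

text \<open>
  A flip-flop family with sojourns, with all constants made explicit. The sequence \<open>\<zeta>\<close> serves for
  both kinds of contraction and is bounded by \<open>Z\<close>. A sojourn followed by flip-flop steps loses the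
  product of two such bounds, hence the constant \<open>Z * Z\<close>. Of the two pieces that a sojourn
  provides one is enough, so the sign of the plaque reached at its end is dropped.
\<close>
locale flip_flop_sojourns =
  plaque_dynamics f \<phi> "Fp \<union> Fm" "Z * Z" C \<Delta>
  for f :: "'a::metric_space \<Rightarrow> 'a" and \<phi> :: "'a \<Rightarrow> real" and Fp Fm :: "'a set set"
    and Z C \<Delta> :: real +
  fixes Y :: "'a set" and \<alpha> :: real and \<zeta> :: "nat \<Rightarrow> real"
  assumes rate_ge_1: "1 \<le> Z" and rate_bound: "\<And>n. \<zeta> n \<le> Z" and rate_lim: "\<zeta> \<longlonglongrightarrow> 0"
    and \<alpha>_pos: "0 < \<alpha>" and \<alpha>_le_C: "\<alpha> \<le> C"
    and positive: "\<And>D x. D \<in> Fp \<Longrightarrow> x \<in> D \<Longrightarrow> \<alpha> \<le> \<phi> x"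
    and negative: "\<And>D x. D \<in> Fm \<Longrightarrow> x \<in> D \<Longrightarrow> \<phi> x \<le> - \<alpha>"
    and successors: "\<And>D. D \<in> Fp \<union> Fm \<Longrightarrow> (\<exists>D'\<in>Fp. D' \<subseteq> f ` D) \<and> (\<exists>D'\<in>Fm. D' \<subseteq> f ` D)"
    and contraction: "\<And>n (D :: nat \<Rightarrow> 'a set) i x y. 0 < n \<Longrightarrow> \<forall>i\<le>n. D i \<in> Fp \<union> Fm \<Longrightarrow>
        \<forall>i<n. D (Suc i) \<subseteq> f ` D i \<Longrightarrow> i \<le> n \<Longrightarrow> (f ^^ n) x \<in> D n \<Longrightarrow> (f ^^ n) y \<in> D n \<Longrightarrow>
        dist ((f ^^ (n - i)) x) ((f ^^ (n - i)) y) \<le> \<zeta> i * dist ((f ^^ n) x) ((f ^^ n) y)"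
    and sojourns: "\<And>\<delta>. 0 < \<delta> \<Longrightarrow> \<exists>N. \<forall>D\<in>Fp \<union> Fm. \<exists>A\<subseteq>D. (f ^^ N) ` A \<in> Fp \<union> Fm \<and>
        (\<forall>x\<in>A. delta_dense \<delta> ((\<lambda>i. (f ^^ i) x) ` {0..N}) Y) \<and>
        (\<forall>x\<in>A. \<forall>y\<in>A. \<forall>i\<le>N. dist ((f ^^ (N - i)) x) ((f ^^ (N - i)) y)
           \<le> \<zeta> i * dist ((f ^^ N) x) ((f ^^ N) y))"
begin

abbreviation F :: "'a set set" where
  "F \<equiv> Fp \<union> Fm"

text \<open>
  One can stay in plaques of one chosen sign for \<open>n\<close> steps. At time \<open>0\<close> the sign is that of \<open>D\<close>.
\<close>
lemma signed_run:
  assumes "D \<in> F" and \<sigma>: "\<sigma> \<in> {-1, 1::real}" and "0 < n"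
  shows "\<exists>A\<subseteq>D. (f ^^ n) ` A \<in> F \<and>
    (\<forall>x\<in>A. \<forall>y\<in>A. \<forall>i\<le>n. dist ((f ^^ (n - i)) x) ((f ^^ (n - i)) y)
       \<le> \<zeta> i * dist ((f ^^ n) x) ((f ^^ n) y)) \<and>
    (\<forall>x\<in>A. \<forall>i. 0 < i \<longrightarrow> i \<le> n \<longrightarrow> \<alpha> \<le> \<sigma> * \<phi> ((f ^^ i) x))"
proof -
  define G where "G = (if \<sigma> = 1 then Fp else Fm)"
  have G: "G \<subseteq> F" and sign: "\<alpha> \<le> \<sigma> * \<phi> x" if "E \<in> G" "x \<in> E" for E x
    using \<sigma> that positive[of E x] negative[of E x] by (auto simp: G_def split: if_splits)
  define run where
    "run E \<longleftrightarrow> (\<forall>i. (E i \<in> F \<and> (i = 0 \<longrightarrow> E i = D)) \<and> (E (Suc i) \<in> G \<and> E (Suc i) \<subseteq> f ` E i))" for E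
  have "\<exists>E. run E"
    unfolding run_def
  proof (rule dependent_nat_choice)
    show "\<exists>X. X \<in> F \<and> (0 = (0::nat) \<longrightarrow> X = D)" using assms(1) by blast
    show "\<exists>X'. (X' \<in> F \<and> (Suc i = 0 \<longrightarrow> X' = D)) \<and> (X' \<in> G \<and> X' \<subseteq> f ` X)"
      if "X \<in> F \<and> (i = 0 \<longrightarrow> X = D)" for X i
      using successors[of X] that by (auto simp: G_def)
  qed
  then obtain E where "run E" by blast
  then have E: "E 0 = D" "E i \<in> F" "E (Suc i) \<in> G" "E (Suc i) \<subseteq> f ` E i" for i
    unfolding run_def by simp_all
  \<comment> \<open>The points whose orbit follows the plaques \<open>E 0, \<dots>, E m\<close>.\<close>
  define A where "A m = {x. \<forall>i\<le>m. (f ^^ i) x \<in> E i}" for m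
  have img: "(f ^^ m) ` A m = E m" for m
  proof (induction m)
    case (Suc m)
    have "y \<in> (f ^^ Suc m) ` A (Suc m)" if y: "y \<in> E (Suc m)" for y
    proof -
      have "y \<in> f ` (f ^^ m) ` A m" using E(4) y Suc by auto
      then obtain x where "x \<in> A m" "y = f ((f ^^ m) x)" by blast
      then have "x \<in> A (Suc m)" "y = (f ^^ Suc m) x"
        using y by (auto simp: A_def le_Suc_eq)
      then show ?thesis by blast
    qed
    then show ?case by (auto simp: A_def)
  qed (auto simp: A_def)
  have "A n \<subseteq> D" using E(1) by (auto simp: A_def)
  moreover have "(f ^^ n) ` A n \<in> F" unfolding img by (rule E(2))
  moreover have "dist ((f ^^ (n - i)) x) ((f ^^ (n - i)) y) \<le> \<zeta> i * dist ((f ^^ n) x) ((f ^^ n) y)"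
    if "x \<in> A n" "y \<in> A n" "i \<le> n" for x y i
  proof (rule contraction[OF \<open>0 < n\<close>, of E])
    show "(f ^^ n) x \<in> E n" "(f ^^ n) y \<in> E n" using that img[of n] by blast+
  qed (use E that in auto)
  moreover have "\<alpha> \<le> \<sigma> * \<phi> ((f ^^ i) x)" if "x \<in> A n" "0 < i" "i \<le> n" for x i
  proof -
    have "(f ^^ i) x \<in> E i" "E i \<in> G"
      using that E(3) by (auto simp: A_def gr0_conv_Suc)
    then show ?thesis using sign by blast
  qed
  ultimately show ?thesis by (intro exI[of _ "A n"]) auto
qed

lemma steerable_base:
  "\<exists>L>0. 3 dvd L \<and> steerable L (\<lambda>_. True) (\<alpha> / 2) C"
proof -
  have "\<forall>\<^sub>F n in sequentially. \<zeta> n < 1 / 2"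
    using rate_lim by (rule order_tendstoD) simp
  then obtain n0 where n0: "\<And>n. n \<ge> n0 \<Longrightarrow> \<zeta> n < 1 / 2"
    by (auto simp: eventually_sequentially)
  obtain n1 :: nat where n1: "(\<alpha> + C) / (\<alpha> / 2) < n1" using reals_Archimedean2 by blast
  define n where "n = 3 * (n0 + n1) + 2"
  have "steerable (Suc n) (\<lambda>_. True) (\<alpha> / 2) C"
    unfolding steerable_def
  proof (intro ballI)
    fix D and \<sigma> :: real assume D: "D \<in> F" and \<sigma>: "\<sigma> \<in> {-1, 1}"
    obtain A where A: "A \<subseteq> D" "(f ^^ Suc n) ` A \<in> F"
      and contr: "\<forall>x\<in>A. \<forall>y\<in>A. \<forall>i\<le>Suc n. dist ((f ^^ (Suc n - i)) x) ((f ^^ (Suc n - i)) y)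
       \<le> \<zeta> i * dist ((f ^^ Suc n) x) ((f ^^ Suc n) y)"
      and sign: "\<forall>x\<in>A. \<forall>i. 0 < i \<longrightarrow> i \<le> Suc n \<longrightarrow> \<alpha> \<le> \<sigma> * \<phi> ((f ^^ i) x)"
      using signed_run[OF D \<sigma>, of "Suc n"] by blast
    have "dist ((f ^^ i) x) ((f ^^ i) y) \<le> Z * Z * dist ((f ^^ Suc n) x) ((f ^^ Suc n) y)"
      if "x \<in> A" "y \<in> A" "i \<le> Suc n" for x y i
    proof -
      have "dist ((f ^^ i) x) ((f ^^ i) y) \<le> \<zeta> (Suc n - i) * dist ((f ^^ Suc n) x) ((f ^^ Suc n) y)"
        using contr[rule_format, OF that(1,2), of "Suc n - i"] that(3) by simp
      also have "\<dots> \<le> Z * Z * dist ((f ^^ Suc n) x) ((f ^^ Suc n) y)"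
      proof (rule mult_right_mono)
        show "\<zeta> (Suc n - i) \<le> Z * Z"
          using rate_bound[of "Suc n - i"] rate_ge_1 mult_right_mono[of 1 Z Z] by linarith
      qed simp
      finally show ?thesis .
    qed
    then have seg: "segment (Suc n) D A"
      using A unfolding segment_def by blast
    have half: "dist x y \<le> dist ((f ^^ Suc n) x) ((f ^^ Suc n) y) / 2" if "x \<in> A" "y \<in> A" for x y
    proof -
      have "dist x y \<le> \<zeta> (Suc n) * dist ((f ^^ Suc n) x) ((f ^^ Suc n) y)"
        using contr[rule_format, OF that, of "Suc n"] by simp
      also have "\<dots> \<le> 1 / 2 * dist ((f ^^ Suc n) x) ((f ^^ Suc n) y)"
        using n0[of "Suc n"] by (intro mult_right_mono) (auto simp: n_def)
      finally show ?thesis by simp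
    qed
    have "\<alpha> / 2 * Suc n \<le> \<sigma> * S (Suc n) x \<and> \<sigma> * S (Suc n) x \<le> C * Suc n" if "x \<in> A" for x
    proof -
      have "\<sigma> * S (Suc n) x = \<sigma> * \<phi> x + (\<Sum>i<n. \<sigma> * \<phi> ((f ^^ Suc i) x))"
        unfolding birkhoff_sum_def by (subst sum.lessThan_Suc_shift) (simp add: sum_distrib_left distrib_left)
      moreover have "(\<Sum>i<n. \<sigma> * \<phi> ((f ^^ Suc i) x)) \<ge> of_nat (card {..<n}) * \<alpha>"
        using sign that by (intro sum_bounded_below) (auto simp del: funpow.simps)
      moreover have "\<sigma> * \<phi> x \<ge> - C" using \<phi>_bound[of x] \<sigma> by auto
      moreover have "\<alpha> + C \<le> \<alpha> / 2 * Suc n"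
      proof -
        have "(\<alpha> + C) / (\<alpha> / 2) \<le> Suc n" using n1 by (simp add: n_def)
        then show ?thesis using \<alpha>_pos by (simp add: field_simps)
      qed
      ultimately have "\<alpha> / 2 * Suc n \<le> \<sigma> * S (Suc n) x" by (simp add: algebra_simps)
      moreover have "\<sigma> * S (Suc n) x \<le> C * Suc n"
        using birkhoff_bound[of "Suc n" x] \<sigma> by auto
      ultimately show ?thesis by blast
    qed
    with seg half show "\<exists>A. segment (Suc n) D A \<and>
        (\<forall>x\<in>A. \<forall>y\<in>A. dist x y \<le> dist ((f ^^ Suc n) x) ((f ^^ Suc n) y) / 2) \<and>
        (\<forall>x\<in>A. True \<and> \<alpha> / 2 * real (Suc n) \<le> \<sigma> * S (Suc n) x \<and> \<sigma> * S (Suc n) x \<le> C * real (Suc n))"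
      by blast
  qed
  moreover have "Suc n = 3 * (n0 + n1 + 1)" by (simp add: n_def)
  ultimately show ?thesis by (metis dvd_triv_left zero_less_Suc)
qed

text \<open>
  A sojourn prolonged by flip-flop steps to a multiple of any given length \<open>L\<close>. The number \<open>Suc N\<close>
  of windows of length \<open>L\<close> does not depend on \<open>L\<close>.
\<close>
lemma sojourn_segment:
  assumes "0 < \<delta>"
  shows "\<exists>N. \<forall>L>0. \<forall>D\<in>F. \<exists>A. segment (Suc N * L) D A \<and>
      (\<forall>x\<in>A. delta_dense \<delta> ((\<lambda>i. (f ^^ i) x) ` {0..N}) Y)"
proof -
  obtain N where N: "\<And>D. D \<in> F \<Longrightarrow> \<exists>A\<subseteq>D. (f ^^ N) ` A \<in> Fp \<union> Fm \<and>
        (\<forall>x\<in>A. delta_dense \<delta> ((\<lambda>i. (f ^^ i) x) ` {0..N}) Y) \<and>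
        (\<forall>x\<in>A. \<forall>y\<in>A. \<forall>i\<le>N. dist ((f ^^ (N - i)) x) ((f ^^ (N - i)) y)
           \<le> \<zeta> i * dist ((f ^^ N) x) ((f ^^ N) y))"
    using sojourns[OF assms] by blast
  have "\<exists>A. segment (Suc N * L) D A \<and> (\<forall>x\<in>A. delta_dense \<delta> ((\<lambda>i. (f ^^ i) x) ` {0..N}) Y)"
    if "0 < L" and D: "D \<in> F" for L D
  proof -
    define j where "j = Suc N * L - N"
    have "Suc N * 1 \<le> Suc N * L" using \<open>0 < L\<close> by (intro mult_le_mono2) simp
    then have j: "0 < j" "Suc N * L = j + N" by (simp_all add: j_def)
    obtain A where A: "A \<subseteq> D" "(f ^^ N) ` A \<in> F"
        "\<forall>x\<in>A. delta_dense \<delta> ((\<lambda>i. (f ^^ i) x) ` {0..N}) Y"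
        "\<forall>x\<in>A. \<forall>y\<in>A. \<forall>i\<le>N. dist ((f ^^ (N - i)) x) ((f ^^ (N - i)) y)
           \<le> \<zeta> i * dist ((f ^^ N) x) ((f ^^ N) y)"
      using N[OF D] by blast
    obtain A1 where A1: "A1 \<subseteq> (f ^^ N) ` A" "(f ^^ j) ` A1 \<in> F"
        "\<forall>x\<in>A1. \<forall>y\<in>A1. \<forall>i\<le>j. dist ((f ^^ (j - i)) x) ((f ^^ (j - i)) y)
           \<le> \<zeta> i * dist ((f ^^ j) x) ((f ^^ j) y)"
      using signed_run[OF A(2), of 1 j] j(1) by blast
    define A' where "A' = {x \<in> A. (f ^^ N) x \<in> A1}"
    have "(f ^^ N) ` A' = A1" using A1(1) by (auto simp: A'_def)
    then have "(f ^^ (j + N)) ` A' \<in> F"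
      using A1(2) by (simp only: funpow_add image_comp[symmetric])
    moreover have "dist ((f ^^ i) x) ((f ^^ i) y) \<le> Z * Z * dist ((f ^^ (j + N)) x) ((f ^^ (j + N)) y)"
      if x: "x \<in> A'" and y: "y \<in> A'" and i: "i \<le> j + N" for x y i
    proof -
      let ?e = "dist ((f ^^ (j + N)) x) ((f ^^ (j + N)) y)"
      have second: "dist ((f ^^ (k + N)) x) ((f ^^ (k + N)) y) \<le> Z * ?e" if "k \<le> j" for k
      proof -
        have "dist ((f ^^ (k + N)) x) ((f ^^ (k + N)) y) \<le> \<zeta> (j - k) * ?e"
          using A1(3)[rule_format, of "(f ^^ N) x" "(f ^^ N) y" "j - k"] x y that
          by (simp add: A'_def funpow_add)
        also have "\<dots> \<le> Z * ?e" using rate_bound by (intro mult_right_mono) auto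
        finally show ?thesis .
      qed
      show ?thesis
      proof (cases "i \<le> N")
        case True
        have "dist ((f ^^ i) x) ((f ^^ i) y) \<le> \<zeta> (N - i) * dist ((f ^^ N) x) ((f ^^ N) y)"
          using A(4)[rule_format, of x y "N - i"] x y True by (simp add: A'_def)
        also have "\<dots> \<le> Z * dist ((f ^^ N) x) ((f ^^ N) y)"
          using rate_bound by (intro mult_right_mono) auto
        also have "\<dots> \<le> Z * (Z * ?e)"
          using second[of 0] rate_ge_1 by (intro mult_left_mono) auto
        finally show ?thesis by (simp add: mult.assoc)
      next
        case False
        then have "dist ((f ^^ i) x) ((f ^^ i) y) \<le> Z * ?e"
          using second[of "i - N"] i by simp
        also have "\<dots> \<le> Z * (Z * ?e)"
          using rate_ge_1 mult_right_mono[of 1 Z ?e] by (intro mult_left_mono) auto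
        finally show ?thesis by (simp add: mult.assoc)
      qed
    qed
    moreover have "A' \<subseteq> D" using A(1) by (auto simp: A'_def)
    ultimately have "segment (Suc N * L) D A'"
      unfolding segment_def j(2) by blast
    moreover have "\<forall>x\<in>A'. delta_dense \<delta> ((\<lambda>i. (f ^^ i) x) ` {0..N}) Y"
      using A(3) by (auto simp: A'_def)
    ultimately show ?thesis by blast
  qed
  then show ?thesis by blast
qed

text \<open>The first \<open>L\<close> points of the orbit of \<open>x\<close> are \<open>\<delta>\<close>-dense in \<open>Y\<close>.\<close>
definition dense_orbit :: "real \<Rightarrow> nat \<Rightarrow> 'a \<Rightarrow> bool" where
  "dense_orbit \<delta> L x \<longleftrightarrow> delta_dense \<delta> ((\<lambda>i. (f ^^ i) x) ` {..<L}) Y"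

text \<open>
  The requirement on a block of the next level that consists of \<open>\<kappa>\<close> blocks of length \<open>L\<close>, in terms
  of its starting point \<open>x\<close>: every block of length \<open>L\<close> has average at most \<open>B\<close> in absolute value,
  the orbit along the middle one, number \<open>\<kappa> div 2\<close>, is \<open>\<delta>\<close>-dense in \<open>Y\<close>, and the others satisfy the requirement \<open>P\<close> of their own level.
\<close>
definition block_cond :: "nat \<Rightarrow> real \<Rightarrow> real \<Rightarrow> nat \<Rightarrow> ('a \<Rightarrow> bool) \<Rightarrow> 'a \<Rightarrow> bool" where
  "block_cond L B \<delta> \<kappa> P x \<longleftrightarrow>
     (\<forall>q<\<kappa>. \<bar>S L ((f ^^ (q * L)) x)\<bar> \<le> B * L \<and>
        (if q = \<kappa> div 2 then dense_orbit \<delta> L ((f ^^ (q * L)) x) else P ((f ^^ (q * L)) x)))"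

text \<open>
  The passage to the next level for both types of blocks. A block of the next level that has to be
  dense starts with a sojourn, after which ordinary blocks bring the Birkhoff sum to its target.
\<close>
lemma steerable_next:
  assumes "0 < b" "0 < L" "0 < \<delta>'" "3 * b / 4 \<le> B'"
    and P: "steerable L P b B" and dense: "steerable L (dense_orbit \<delta> L) b B"
  shows "\<exists>\<kappa>0. \<forall>\<kappa>\<ge>\<kappa>0. steerable (\<kappa> * L) (block_cond L B \<delta> \<kappa> P) (b / 4) B' \<and>
      steerable (\<kappa> * L) (dense_orbit \<delta>' (\<kappa> * L)) (b / 4) B'"
proof -
  obtain N where N: "\<forall>D\<in>F. \<exists>A. segment (Suc N * L) D A \<and>
      (\<forall>x\<in>A. delta_dense \<delta>' ((\<lambda>i. (f ^^ i) x) ` {0..N}) Y)"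
    using sojourn_segment[OF assms(3)] \<open>0 < L\<close> by meson
  obtain k1 where k1: "\<forall>\<kappa>\<ge>k1. \<forall>P R. (\<forall>q. steerable L (P q) b B) \<longrightarrow>
      (\<forall>D\<in>F. \<exists>A. segment (0 * L) D A \<and> (\<forall>x\<in>A. R x)) \<longrightarrow>
      steerable (\<kappa> * L) (itinerary (0 * L) L (\<kappa> - 0) R P) (b / 4) (3 * b / 4)"
    using steerable_concat[OF assms(1,2), of B 0] by (rule exE)
  obtain k2 where k2: "\<forall>\<kappa>\<ge>k2. \<forall>P R. (\<forall>q. steerable L (P q) b B) \<longrightarrow>
      (\<forall>D\<in>F. \<exists>A. segment (Suc N * L) D A \<and> (\<forall>x\<in>A. R x)) \<longrightarrow>
      steerable (\<kappa> * L) (itinerary (Suc N * L) L (\<kappa> - Suc N) R P) (b / 4) (3 * b / 4)"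
    using steerable_concat[OF assms(1,2), of B "Suc N"] by (rule exE)
  have "steerable (\<kappa> * L) (block_cond L B \<delta> \<kappa> P) (b / 4) B'" if "k1 \<le> \<kappa>" for \<kappa>
  proof -
    define P' where "P' q x \<longleftrightarrow> \<bar>S L x\<bar> \<le> B * L \<and> (if q = \<kappa> div 2 then dense_orbit \<delta> L x else P x)"
      for q x
    have "steerable L (P' q) b B" for q
    proof (cases "q = \<kappa> div 2")
      case True
      then show ?thesis
        by (intro steerable_weaken[OF dense assms(1) order_refl]) (simp add: P'_def)
    next
      case False
      then show ?thesis
        by (intro steerable_weaken[OF P assms(1) order_refl]) (simp add: P'_def)
    qed
    moreover have "\<forall>D\<in>F. \<exists>A. segment (0 * L) D A \<and> (\<forall>x\<in>A. True)"
      using rate_ge_1 mult_mono[of 1 Z 1 Z] mult_right_mono[of 1 "Z * Z"]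
      by (auto simp: segment_def)
    ultimately have "steerable (\<kappa> * L) (itinerary (0 * L) L (\<kappa> - 0) (\<lambda>_. True) P') (b / 4) (3 * b / 4)"
      using k1 that by blast
    then show ?thesis
      by (rule steerable_weaken) (use assms in \<open>auto simp: block_cond_def P'_def itinerary_def\<close>)
  qed
  moreover have "steerable (\<kappa> * L) (dense_orbit \<delta>' (\<kappa> * L)) (b / 4) B'" if "max k2 (Suc N) \<le> \<kappa>" for \<kappa>
  proof -
    have "N < \<kappa> * L" using that \<open>0 < L\<close>
      by (metis Suc_le_eq less_le_trans max.boundedE mult.right_neutral mult_le_mono2 One_nat_def)
    then have sub: "{0..N} \<subseteq> {..<\<kappa> * L}" by auto
    have "steerable (\<kappa> * L) (itinerary (Suc N * L) L (\<kappa> - Suc N)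
        (\<lambda>x. delta_dense \<delta>' ((\<lambda>i. (f ^^ i) x) ` {0..N}) Y) (\<lambda>_. P)) (b / 4) (3 * b / 4)"
      using k2 that P N by simp
    then show ?thesis
      by (rule steerable_weaken)
        (use assms delta_dense_mono[OF _ image_mono[OF sub]] in \<open>auto simp: dense_orbit_def itinerary_def\<close>)
  qed
  ultimately show ?thesis by (intro exI[of _ "max k1 (max k2 (Suc N))"]) auto
qed

text \<open>
  All levels together: \<open>T n\<close> is the length of the blocks of level \<open>n\<close>, \<open>K n\<close> the number of them in a
  block of level \<open>n + 1\<close>, and \<open>P n\<close> the requirement on a block of level \<open>n\<close> outside the tail. The
  lower bounds on \<open>K\<close> keep the middle block away from the ends, make the tail sparse, and give
  the growth required of a scale.
\<close>
lemma steering_hierarchy: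
  "\<exists>(T :: nat \<Rightarrow> nat) (K :: nat \<Rightarrow> nat) (P :: nat \<Rightarrow> 'a \<Rightarrow> bool).
     0 < T 0 \<and> 3 dvd T 0 \<and>
     (\<forall>n. T (Suc n) = K n * T n \<and> 9 \<le> K n \<and> 2 ^ (n + 2) < K n \<and> n * K n \<le> K (Suc n) \<and>
        P (Suc n) = block_cond (T n) (3 * C / 4 ^ n) (\<Delta> / (n + 1)) (K n) (P n) \<and>
        (\<forall>D\<in>F. \<exists>x\<in>D. P n x))"
proof -
  have "0 < \<Delta>" using diam[of undefined undefined] zero_le_dist by (rule le_less_trans[rotated])
  define a where "a n = \<alpha> / 2 / 4 ^ n" for n :: nat
  define B where "B n = 3 * C / 4 ^ n" for n :: nat
  define \<delta> where "\<delta> n = \<Delta> / (n + 1)" for n :: nat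
  have a: "0 < a n" "a (Suc n) = a n / 4" "0 < \<delta> n" "3 * a n / 4 \<le> B (Suc n)" for n
    using \<alpha>_pos \<alpha>_le_C \<open>0 < \<Delta>\<close> by (auto simp: a_def B_def \<delta>_def field_simps)
  \<comment> \<open>The third component of a state is the ratio of its length to the previous one; it is
    arbitrary at level \<open>0\<close>.\<close>
  define I where "I n s = (case s of (L, P, k) \<Rightarrow> 0 < L \<and> (n = 0 \<longrightarrow> 3 dvd L) \<and>
      steerable L P (a n) (B n) \<and> steerable L (dense_orbit (\<delta> n) L) (a n) (B n))"
    for n :: nat and s :: "nat \<times> ('a \<Rightarrow> bool) \<times> nat"
  define Q where "Q n s s' = (case s of (L, P, k) \<Rightarrow> case s' of (L', P', k') \<Rightarrow>
      L' = k' * L \<and> P' = block_cond L (B n) (\<delta> n) k' P \<and> 9 \<le> k' \<and> 2 ^ (n + 2) < k' \<and> n * k \<le> k')"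
    for n :: nat and s s' :: "nat \<times> ('a \<Rightarrow> bool) \<times> nat"
  have "\<exists>s. I 0 s"
  proof -
    obtain L where L: "0 < L" "3 dvd L" "steerable L (\<lambda>_. True) (\<alpha> / 2) C"
      using steerable_base by blast
    have "steerable L (\<lambda>_. True) (a 0) (B 0)"
      using L(3) by (auto simp: a_def B_def intro!: steerable_weaken[OF L(3)] \<alpha>_pos C_pos[THEN less_imp_le])
    moreover from this have "steerable L (dense_orbit (\<delta> 0) L) (a 0) (B 0)"
    \<comment> \<open>At level \<open>0\<close> the radius exceeds all distances, so every block is dense.\<close>
    proof (rule steerable_weaken[OF _ a(1) order_refl])
      show "dense_orbit (\<delta> 0) L x" for x
        using diam[of x] L(1) by (auto simp: dense_orbit_def delta_dense_def \<delta>_def intro!: bexI[of _ 0])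
    qed
    ultimately show ?thesis using L by (auto simp: I_def)
  qed
  moreover have "\<exists>s'. I (Suc n) s' \<and> Q n s s'" if I: "I n s" for n s
  proof -
    obtain L P k where s: "s = (L, P, k)" by (cases s)
    obtain \<kappa>0 where \<kappa>0: "\<forall>\<kappa>\<ge>\<kappa>0. steerable (\<kappa> * L) (block_cond L (B n) (\<delta> n) \<kappa> P) (a n / 4) (B (Suc n)) \<and>
      steerable (\<kappa> * L) (dense_orbit (\<delta> (Suc n)) (\<kappa> * L)) (a n / 4) (B (Suc n))"
      using steerable_next[OF a(1)[of n] _ a(3)[of "Suc n"] a(4)[of n], of L P "B n" "\<delta> n"] I
      unfolding s I_def by auto
    define \<kappa> where "\<kappa> = \<kappa>0 + 9 + 2 ^ (n + 2) + n * k"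
    have "I (Suc n) (\<kappa> * L, block_cond L (B n) (\<delta> n) \<kappa> P, \<kappa>)"
      using \<kappa>0 I unfolding I_def s a(2) by (auto simp: \<kappa>_def)
    moreover have "Q n s (\<kappa> * L, block_cond L (B n) (\<delta> n) \<kappa> P, \<kappa>)"
      unfolding Q_def s by (auto simp: \<kappa>_def)
    ultimately show ?thesis by blast
  qed
  ultimately have "\<exists>s. \<forall>n. I n (s n) \<and> Q n (s n) (s (Suc n))"
    by (rule dependent_nat_choice)
  then obtain s where s: "\<And>n. I n (s n) \<and> Q n (s n) (s (Suc n))"
    by blast
  define T where "T n = fst (s n)" for n
  define P where "P n = fst (snd (s n))" for n
  define K where "K n = snd (snd (s (Suc n)))" for n
  have 1: "0 < T n" "n = 0 \<longrightarrow> 3 dvd T n" "steerable (T n) (P n) (a n) (B n)" for n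
    using s[of n] by (auto simp: I_def T_def P_def split: prod.splits)
  have 2: "T (Suc n) = K n * T n \<and> P (Suc n) = block_cond (T n) (B n) (\<delta> n) (K n) (P n) \<and>
      9 \<le> K n \<and> 2 ^ (n + 2) < K n" for n
    using s[of n] by (auto simp: Q_def T_def P_def K_def split: prod.splits)
  have 3: "n * K n \<le> K (Suc n)" for n
    using s[of "Suc n"] by (auto simp: Q_def K_def split: prod.splits)
  have 4: "\<exists>x\<in>D. P n x" if D: "D \<in> F" for D n
  proof -
    have "(1::real) \<in> {-1, 1}" by simp
    then obtain A where "segment (T n) D A" "\<forall>x\<in>A. P n x"
      using 1(3)[of n] D unfolding steerable_def by meson
    moreover from this have "A \<noteq> {}" using plaque_nonempty by (auto simp: segment_def)
    ultimately show ?thesis by (auto simp: segment_def)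
  qed
  have 5: "P (Suc n) = block_cond (T n) (3 * C / 4 ^ n) (\<Delta> / (n + 1)) (K n) (P n)" for n
    using 2[of n] unfolding B_def \<delta>_def by blast
  show ?thesis
  proof (rule exI[of _ T], rule exI[of _ K], rule exI[of _ P], intro conjI allI ballI)
    show "0 < T 0" "3 dvd T 0" using 1[of 0] by auto
  qed (use 2 3 4 5 in blast)+
qed

end

section \<open>The tail formed by the middle blocks\<close>
lemma nat_component_unique:
  assumes "nat_component R I" "nat_component R J" "t \<in> I" "t \<in> J"
  shows "I = J"
proof -
  have le: "{a..b} \<subseteq> {c..d}"
    if "t \<in> {a..b}" "t \<in> {c..d}" "{a..b} \<subseteq> R" "c = 0 \<or> c - 1 \<notin> R" "d + 1 \<notin> R"
    for a b c d
  proof -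
    have "c \<le> a"
    proof (rule ccontr)
      assume "\<not> c \<le> a"
      then have "c - 1 \<in> {a..b}" "c \<noteq> 0" using that(1,2) by auto
      then show False using that(3,4) by blast
    qed
    moreover have "b \<le> d"
    proof (rule ccontr)
      assume "\<not> b \<le> d"
      then have "d + 1 \<in> {a..b}" using that(1,2) by auto
      then show False using that(3,5) by blast
    qed
    ultimately show ?thesis by auto
  qed
  obtain a b where I: "I = {a..b}" "{a..b} \<subseteq> R" "a = 0 \<or> a - 1 \<notin> R" "b + 1 \<notin> R"
    using assms(1) unfolding nat_component_def by blast
  obtain c d where J: "J = {c..d}" "{c..d} \<subseteq> R" "c = 0 \<or> c - 1 \<notin> R" "d + 1 \<notin> R"
    using assms(2) unfolding nat_component_def by blast
  show ?thesis
    using le[of a b c d] le[of c d a b] assms(3,4) I J by auto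
qed

text \<open>
  Block lengths \<open>T\<close> with ratios \<open>K n = T (n + 1) / T n\<close>. The bound \<open>9\<close> leaves enough room for the
  middle block to avoid the outer thirds.
\<close>
locale block_hierarchy =
  fixes T K :: "nat \<Rightarrow> nat"
  assumes T_0: "0 < T 0" and T_Suc: "\<And>n. T (Suc n) = K n * T n" and K_ge: "\<And>n. 9 \<le> K n"
begin

lemma T_pos: "0 < T n"
proof (induction n)
  case (Suc n)
  then show ?case using T_Suc[of n] K_ge[of n] by simp
qed (rule T_0)

lemma T_less_Suc: "T n < T (Suc n)"
  using T_Suc[of n] K_ge[of n] T_pos[of n] by (cases "K n") auto

lemma strict_mono_T: "strict_mono T"
  by (rule strict_monoI_Suc) (rule T_less_Suc)

lemma T_gt: "n < T n"
proof (induction n)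
  case (Suc n)
  then show ?case using T_less_Suc[of n] by linarith
qed (rule T_pos)

lemma T_dvd: "i \<le> j \<Longrightarrow> T i dvd T j"
  by (induction j rule: dec_induct) (auto simp: T_Suc)

lemma mem_block: "t \<in> block T n k \<longleftrightarrow> t div T n = k"
proof -
  have "t \<in> block T n k \<longleftrightarrow> k * T n \<le> t \<and> t < Suc k * T n"
    using T_pos[of n] by (auto simp: block_def)
  also have "\<dots> \<longleftrightarrow> t div T n = k"
    using div_nat_eqI[of "T n" k t] div_times_less_eq_dividend[of t "T n"]
      dividend_less_div_times[OF T_pos[of n], of t]
    by (auto simp: mult.commute)
  finally show ?thesis .
qed

lemma card_block: "card (block T n k) = T n"
  using T_pos[of n] by (simp add: block_def)

lemma div_coarser:
  assumes "t div T i = s div T i" "i \<le> j"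
  shows "t div T j = s div T j"
proof -
  obtain c where "T j = T i * c" using T_dvd[OF assms(2)] by (elim dvdE)
  then show ?thesis using assms(1) by (simp add: div_mult2_eq)
qed

lemma block_subset_coarser:
  assumes "i \<le> j"
  shows "block T i k \<subseteq> block T j (k * T i div T j)"
proof
  fix t assume "t \<in> block T i k"
  then have "t div T i = k * T i div T i" using T_pos[of i] by (simp add: mem_block)
  from div_coarser[OF this assms] show "t \<in> block T j (k * T i div T j)" by (simp add: mem_block)
qed

text \<open>
  The block number \<open>k\<close> of level \<open>n\<close> is the middle one among the \<open>K n\<close> blocks of level \<open>n\<close> in its
  parent of level \<open>n + 1\<close>.
\<close>
definition marked :: "nat \<Rightarrow> nat \<Rightarrow> bool" where
  "marked n k \<longleftrightarrow> k mod K n = K n div 2"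

text \<open>
  The union of all marked blocks. Marked blocks may be nested; the maximal ones turn out to be
  the components.
\<close>
definition tail :: "nat set" where
  "tail = {t. \<exists>n. marked n (t div T n)}"

text \<open>No block of level greater than \<open>n\<close> that contains \<open>t\<close> is marked.\<close>
definition unmarked_above :: "nat \<Rightarrow> nat \<Rightarrow> bool" where
  "unmarked_above n t \<longleftrightarrow> (\<forall>i>n. \<not> marked i (t div T i))"

lemma unmarked_above_cong:
  assumes "t div T n = s div T n" "unmarked_above n t"
  shows "unmarked_above n s"
  unfolding unmarked_above_def
proof (intro allI impI)
  fix i assume "n < i"
  then have "t div T i = s div T i" by (intro div_coarser[OF assms(1)] less_imp_le)
  moreover have "\<not> marked i (t div T i)" using assms(2) \<open>n < i\<close> unfolding unmarked_above_def by blast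
  ultimately show "\<not> marked i (s div T i)" by metis
qed

lemma not_marked_0: "\<not> marked n 0"
  using K_ge[of n] by (auto simp: marked_def)

text \<open>A point lies in finitely many marked blocks only: at large levels its block has number \<open>0\<close>.\<close>
lemma exists_top_marked:
  assumes "marked n (t div T n)"
  obtains m where "n \<le> m" "marked m (t div T m)" "unmarked_above m t"
proof -
  have bound: "m \<le> t" if "marked m (t div T m)" for m
    using that not_marked_0[of m] T_gt[of m] by (metis div_less leI less_trans)
  define m where "m = (GREATEST m. marked m (t div T m))"
  have "marked m (t div T m)" unfolding m_def by (rule GreatestI_nat[where P = "\<lambda>m. marked m (t div T m)", OF assms bound])
  moreover have "i \<le> m" if "marked i (t div T i)" for i
    unfolding m_def by (rule Greatest_le_nat[where P = "\<lambda>m. marked m (t div T m)", OF that bound])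
  ultimately show ?thesis
    using that[of m] assms by (force simp: unmarked_above_def)
qed

lemma zero_notin_tail: "0 \<notin> tail"
  using not_marked_0 by (auto simp: tail_def)

text \<open>
  The neighbour on either side of a maximal marked block is not in the tail: at lower levels it
  lies in a first or last block of its parent, at the same level next to a middle block, and at
  higher levels in the same block as the given one, because a middle block does not touch the
  ends of its parent.
\<close>
lemma component_block:
  assumes m: "marked n k" and top: "unmarked_above n (k * T n)"
  shows "nat_component tail (block T n k)"
proof -
  have K: "9 \<le> K i" for i by (rule K_ge)
  have k: "k mod K n = K n div 2" using m by (simp add: marked_def)
  have k0: "0 < k" using m not_marked_0 by (cases k) auto
  have sub: "{k * T n..(k + 1) * T n - 1} \<subseteq> tail"
    using m mem_block[of _ n k] by (auto simp: tail_def block_def)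
  have no_above: "\<not> T i dvd k * T n" "\<not> T i dvd Suc k * T n" if "n < i" for i
  proof -
    have "T (Suc n) dvd T i" using that by (intro T_dvd) simp
    moreover have "\<not> T (Suc n) dvd k * T n" "\<not> T (Suc n) dvd Suc k * T n"
    proof -
      have "k mod K n \<noteq> 0" using k K[of n] by simp
      then show "\<not> T (Suc n) dvd k * T n"
        using T_pos[of n] by (auto simp: T_Suc)
      have "Suc k mod K n \<noteq> 0" using k K[of n] by (simp add: mod_Suc)
      then show "\<not> T (Suc n) dvd Suc k * T n"
        using T_pos[of n] by (auto simp: T_Suc simp del: mult_Suc)
    qed
    ultimately show "\<not> T i dvd k * T n" "\<not> T i dvd Suc k * T n" by (meson dvd_trans)+
  qed
  have below: "T (Suc i) dvd c * T n" if "i < n" for i c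
    using T_dvd[of "Suc i" n] that by (simp add: dvd_mult)
  have left: "k * T n - 1 \<notin> tail"
  proof
    assume "k * T n - 1 \<in> tail"
    then obtain i where i: "marked i ((k * T n - 1) div T i)" by (auto simp: tail_def)
    have pos: "0 < k * T n" using k0 T_pos by simp
    consider "i < n" | "i = n" | "n < i" by linarith
    then show False
    proof cases
      case 1
      obtain c where c: "k * T n = c * (K i * T i)"
        using below[OF 1, of k] unfolding T_Suc by (metis dvdE mult.commute)
      then have c0: "0 < c" using pos by (cases c) auto
      have "(k * T n - 1) div T i = c * K i - 1"
      proof (rule div_nat_eqI)
        show "T i * (c * K i - 1) \<le> k * T n - 1" "k * T n - 1 < T i * Suc (c * K i - 1)"
          using c c0 K[of i] T_pos[of i] by (auto simp: diff_mult_distrib2 algebra_simps)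
      qed
      also have "c * K i - 1 = (c - 1) * K i + (K i - 1)"
        using c0 K[of i] by (cases c) auto
      finally have "((k * T n - 1) div T i) mod K i = K i - 1"
        using K[of i] mod_mult_self3[of "c - 1" "K i" "K i - 1"] by simp
      then show False using i K[of i] by (simp add: marked_def)
    next
      case 2
      have "(k * T n - 1) div T n = k - 1"
      proof (rule div_nat_eqI)
        show "T n * (k - 1) \<le> k * T n - 1" "k * T n - 1 < T n * Suc (k - 1)"
          using k0 T_pos[of n] by (auto simp: diff_mult_distrib2 algebra_simps)
      qed
      then have "(k - 1) mod K n = k mod K n" using i k 2 by (simp add: marked_def)
      moreover have "Suc (k - 1) mod K n = k mod K n" using k0 by simp
      ultimately show False using K[of n] by (auto simp: mod_Suc split: if_splits)
    next
      case 3
      have "Suc (k * T n - 1) = k * T n" using pos by simp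
      then have "k * T n div T i = (k * T n - 1) div T i"
        using no_above(1)[OF 3] div_Suc[of "k * T n - 1" "T i"] by (auto simp: dvd_eq_mod_eq_0)
      then show False using top i 3 unfolding unmarked_above_def by metis
    qed
  qed
  have right: "(k + 1) * T n - 1 + 1 \<notin> tail"
  proof
    have eq: "(k + 1) * T n - 1 + 1 = Suc k * T n" using T_pos[of n] by simp
    assume "(k + 1) * T n - 1 + 1 \<in> tail"
    then obtain i where i: "marked i (Suc k * T n div T i)" unfolding eq by (auto simp: tail_def)
    consider "i < n" | "i = n" | "n < i" by linarith
    then show False
    proof cases
      case 1
      obtain c where c: "Suc k * T n = T i * (K i * c)"
        using below[OF 1, of "Suc k"] unfolding T_Suc by (metis dvdE mult.commute mult.assoc)
      then have "(Suc k * T n div T i) mod K i = 0" unfolding c using T_pos[of i] by simp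
      then show False using i K[of i] by (simp add: marked_def)
    next
      case 2
      have "Suc k * T n div T n = Suc k" using T_pos[of n] by (simp del: mult_Suc)
      then have "Suc k mod K n = k mod K n" using i k 2 by (simp add: marked_def)
      then show False using K[of n] by (auto simp: mod_Suc split: if_splits)
    next
      case 3
      let ?t = "Suc k * T n - 1"
      have "Suc ?t = Suc k * T n" using T_pos[of n] by simp
      then have "Suc k * T n div T i = ?t div T i"
        using no_above(2)[OF 3] div_Suc[of ?t "T i"] by (auto simp: dvd_eq_mod_eq_0)
      moreover have "?t div T i = k * T n div T i"
      proof (rule div_coarser)
        have "?t \<in> block T n k" using T_pos[of n] by (simp add: block_def)
        then show "?t div T n = k * T n div T n" using T_pos[of n] by (simp add: mem_block)
      qed (use 3 in simp)
      ultimately show False using top i 3 unfolding unmarked_above_def by metis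
    qed
  qed
  show ?thesis
    unfolding nat_component_def
  proof (intro exI conjI)
    show "block T n k = {k * T n..(k + 1) * T n - 1}" by (simp add: block_def)
    show "k * T n \<le> (k + 1) * T n - 1" using T_pos[of n] by simp
  qed (use sub left right in auto)
qed

lemma component_is_block:
  assumes "nat_component tail I"
  obtains n k where "I = block T n k" "marked n k" "unmarked_above n (k * T n)"
proof -
  have "I \<noteq> {}" "I \<subseteq> tail"
    using assms by (auto simp: nat_component_def)
  then obtain t where t: "t \<in> I" "t \<in> tail" by blast
  then obtain n where n: "marked n (t div T n)" "unmarked_above n t"
    unfolding tail_def mem_Collect_eq by (meson exists_top_marked)
  let ?k = "t div T n"
  have "?k * T n div T n = t div T n" using T_pos[of n] by simp
  then have "unmarked_above n (?k * T n)"
    using n(2) unmarked_above_cong by metis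
  moreover from component_block[OF n(1) this] have "I = block T n ?k"
    using nat_component_unique[OF assms] t(1) by (simp add: mem_block)
  ultimately show ?thesis using that n(1) by blast
qed

lemma marked_block_in_component:
  assumes "marked i (k * T n div T i)" "n \<le> i"
  obtains j l where "i \<le> j" "nat_component tail (block T j l)" "block T n k \<subseteq> block T j l"
proof -
  obtain j where j: "i \<le> j" "marked j (k * T n div T j)" "unmarked_above j (k * T n)"
    using exists_top_marked[OF assms(1)] by blast
  let ?l = "k * T n div T j"
  have "?l * T j div T j = k * T n div T j" using T_pos[of j] by simp
  then have "unmarked_above j (?l * T j)"
    using j(3) unmarked_above_cong by metis
  then show ?thesis
    using that[OF j(1) component_block[OF j(2)]] block_subset_coarser[of n j k] assms(2) j(1) by simp
qed

lemma tail_level_block: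
  assumes "nat_component tail (block T n k)"
  shows "block T n k \<subseteq> tail_level T tail n"
  using assms card_block by (auto simp: tail_level_def)

lemma unmarked_above_if_not_tail_from:
  assumes "\<not> block T n k \<subseteq> tail_from T tail (n + 1)"
  shows "unmarked_above n (k * T n)"
  unfolding unmarked_above_def
proof (intro allI impI notI)
  fix i assume i: "n < i" "marked i (k * T n div T i)"
  obtain j l where "i \<le> j" "nat_component tail (block T j l)" "block T n k \<subseteq> block T j l"
    using marked_block_in_component[OF i(2)] i(1) by (metis less_imp_le)
  then have "block T n k \<subseteq> tail_level T tail j" "n + 1 \<le> j"
    using tail_level_block i(1) by fastforce+
  then have "block T n k \<subseteq> tail_from T tail (n + 1)" by (auto simp: tail_from_def)
  then show False using assms by blast
qed

text \<open>
  A block of level \<open>n + 1\<close> outside the components contains exactly one component of size \<open>T n\<close>,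
  its middle block \<open>c\<close>.
\<close>
lemma tail_level_in_block:
  assumes "\<nexists>J. nat_component tail J \<and> block T (Suc n) k \<subseteq> J"
  defines "c \<equiv> k * K n + K n div 2"
  shows "tail_level T tail n \<inter> block T (Suc n) k = block T n c"
proof -
  have c: "c mod K n = K n div 2" "c div K n = k"
    using K_ge[of n] by (auto simp: c_def)
  have child: "c * T n div T (Suc n) = k"
    using c(2) T_pos[of n] by (simp add: T_Suc)
  have coarse: "c * T n div T i = k * T (Suc n) div T i" if "n < i" for i
  proof (rule div_coarser)
    show "c * T n div T (Suc n) = k * T (Suc n) div T (Suc n)"
      unfolding child using T_pos[of "Suc n"] by simp
  qed (use that in simp)
  have "unmarked_above n (c * T n)"
    unfolding unmarked_above_def
  proof (intro allI impI notI)
    fix i assume "n < i" "marked i (c * T n div T i)"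
    then obtain j l where "nat_component tail (block T j l)" "block T (Suc n) k \<subseteq> block T j l"
      using marked_block_in_component[of i k "Suc n"] coarse[of i] by (metis Suc_leI)
    then show False using assms(1) by blast
  qed
  moreover have "marked n c" using c(1) by (simp add: marked_def)
  ultimately have "nat_component tail (block T n c)" by (intro component_block)
  then have "block T n c \<subseteq> tail_level T tail n" by (rule tail_level_block)
  moreover have "block T n c \<subseteq> block T (Suc n) k"
    using block_subset_coarser[of n "Suc n" c] child by simp
  moreover have "t \<in> block T n c" if t: "t \<in> tail_level T tail n" "t \<in> block T (Suc n) k" for t
  proof -
    obtain I where I: "nat_component tail I" "card I = T n" "t \<in> I"
      using t(1) by (auto simp: tail_level_def)
    obtain m l where l: "I = block T m l" "marked m l"
      using component_is_block[OF I(1)] by blast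
    have "m = n" using I(2) card_block[of m l] l(1) strict_mono_eq[OF strict_mono_T] by simp
    then have "t div T n = l" "l mod K n = K n div 2"
      using l I(3) by (auto simp: mem_block marked_def)
    moreover from this have "l div K n = k"
      using t(2) by (simp add: mem_block T_Suc div_mult2_eq mult.commute[of "K n"])
    ultimately have "t div T n = c"
      unfolding c_def by (metis div_mult_mod_eq)
    then show ?thesis by (simp add: mem_block)
  qed
  ultimately show ?thesis by blast
qed

lemma long_sparse_tail_tail:
  assumes \<epsilon>: "\<And>n. 1 / real (K n) < \<epsilon> (Suc n)"
  shows "long_sparse_tail T \<epsilon> tail"
  unfolding long_sparse_tail_def
proof (intro conjI allI impI)
  show "\<exists>n k. I = block T n k" if "nat_component tail I" for I
    using component_is_block[OF that] by blast
  show "0 \<notin> tail" by (rule zero_notin_tail)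
  fix n k :: nat assume "1 \<le> n" and *: "\<nexists>J. nat_component tail J \<and> block T n k \<subseteq> J"
  then obtain p where n: "n = Suc p" by (cases n) auto
  define h where "h = K p div 2"
  have level: "tail_level T tail p \<inter> block T n k = block T p (k * K p + h)"
    using tail_level_in_block[of p k] * unfolding n h_def by blast
  have T: "T n = K p * T p" and p: "n - 1 = p" unfolding n by (auto simp: T_Suc)
  have start: "k * T n + h * T p \<le> t" and stop: "t < k * T n + (h + 1) * T p"
    if "t \<in> block T p (k * K p + h)" for t
    using that T_pos[of p] by (auto simp: block_def T algebra_simps)
  have "3 * (T n div 3) \<le> T n" by simp
  moreover have "3 * h \<ge> K p + 3" "3 * (h + 1) + 1 \<le> 2 * K p"
    using K_ge[of p] unfolding h_def by presburger+
  then have "T n + 3 * T p \<le> 3 * (h * T p)" "3 * ((h + 1) * T p) + T p \<le> 2 * T n"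
    using mult_right_mono[of "K p + 3" "3 * h" "T p"]
      mult_right_mono[of "3 * (h + 1) + 1" "2 * K p" "T p"]
    by (simp_all add: T algebra_simps)
  ultimately have third: "T n div 3 < h * T p" "(h + 1) * T p + T n div 3 < T n"
    using T_pos[of p] by linarith+
  have len: "(k + 1) * T n = k * T n + T n" by simp
  show "{k * T n..k * T n + T n div 3} \<inter> tail_level T tail (n - 1) = {}"
  proof (intro equals0I)
    fix t assume t: "t \<in> {k * T n..k * T n + T n div 3} \<inter> tail_level T tail (n - 1)"
    then have "t \<in> block T n k"
      using third unfolding block_def len by auto
    then show False using t level start[of t] third(1) unfolding p by auto
  qed
  show "{(k + 1) * T n - 1 - T n div 3..(k + 1) * T n - 1} \<inter> tail_level T tail (n - 1) = {}"
  proof (intro equals0I)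
    fix t assume t: "t \<in> {(k + 1) * T n - 1 - T n div 3..(k + 1) * T n - 1} \<inter> tail_level T tail (n - 1)"
    then have "t \<in> block T n k"
      using third unfolding block_def len by auto
    then have "t \<in> block T p (k * K p + h)" using t level unfolding p by blast
    from stop[OF this] have "t < k * T n + (h + 1) * T p" .
    moreover have "k * T n + T n - 1 - T n div 3 \<le> t" using t unfolding len by simp
    ultimately show False using third(2) by linarith
  qed
  have "real (card (tail_level T tail (n - 1) \<inter> block T n k)) / real (T n) = 1 / K p"
    unfolding p level card_block T using T_pos[of p] by simp
  then show "0 < real (card (tail_level T tail (n - 1) \<inter> block T n k)) / real (T n)"
    "real (card (tail_level T tail (n - 1) \<inter> block T n k)) / real (T n) < \<epsilon> n"
    using \<epsilon>[of p] K_ge[of p] unfolding n by auto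
qed

lemma scale_T:
  assumes "3 dvd T 0" and growth: "\<And>n. n * K n \<le> K (Suc n)"
  shows "scale T"
  unfolding scale_def
proof (intro conjI allI exI[of _ "\<lambda>n. K (n - 1)"] impI)
  show "0 < T n" for n by (rule T_pos)
  show "3 dvd T 0" by fact
  show "3 \<le> K (n - 1)" for n using K_ge[of "n - 1"] by simp
  show "T n = K (n - 1) * T (n - 1)" if "1 \<le> n" for n
    using T_Suc[of "n - 1"] that by simp
  show "filterlim (\<lambda>n. real (K (n + 1 - 1)) / real (K (n - 1))) at_top sequentially"
  proof (rule filterlim_at_top_mono)
    show "filterlim (\<lambda>n. real (n - 1)) at_top sequentially"
      by (rule filterlim_compose[OF filterlim_real_sequentially filterlim_minus_const_nat_at_top])
    show "\<forall>\<^sub>F n in sequentially. real (n - 1) \<le> real (K (n + 1 - 1)) / real (K (n - 1))"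
      using eventually_gt_at_top[of 0]
    proof eventually_elim
      case (elim n)
      have "real ((n - 1) * K (n - 1)) \<le> real (K n)"
        using growth[of "n - 1"] elim by (simp only: of_nat_le_iff) simp
      then show ?case using K_ge[of "n - 1"] by (simp add: field_simps)
    qed
  qed
qed

end

text \<open>The exponent \<open>Suc n\<close> makes all factors \<open>1 - \<epsilon> n\<close> positive.\<close>
lemma controlling_sequence_geometric: "controlling_sequence (\<lambda>n. (1 / 2) ^ Suc n)"
proof -
  let ?e = "\<lambda>n. (1 / 2 :: real) ^ Suc n"
  have summable: "summable ?e" using summable_geometric[of "1 / 2 :: real"] by (subst summable_Suc_iff) simp
  have le: "?e n \<le> 1 / 2" for n using power_decreasing[of 1 "Suc n" "1 / 2 :: real"] by simp
  have "convergent_prod (\<lambda>n. 1 + - ?e n)"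
  proof (rule summable_imp_convergent_prod_real)
    show "- ?e n \<noteq> -1" for n using le[of n] by simp
  qed (use summable in auto)
  then have prod: "convergent_prod (\<lambda>n. 1 - ?e n)" by simp
  moreover have "0 < (\<Prod>n. 1 - ?e n)"
    by (rule less_0_prodinf[OF prod]) (use le in \<open>smt (verit) field_sum_of_halves\<close>)
  moreover have "?e \<longlonglongrightarrow> 0" using summable by (rule summable_LIMSEQ_zero)
  ultimately show ?thesis using summable unfolding controlling_sequence_def by auto
qed

section \<open>Controlled points\<close>

context flip_flop_sojourns
begin

text \<open>
  Unfolding of the recursive requirement \<open>P n\<close> on the block of level \<open>n\<close> with number \<open>q\<close>: it controls
  each block of level \<open>j < n\<close> inside that is not contained in a marked block of a level between.
\<close>
lemma block_cond_hierarchy: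
  assumes hier: "block_hierarchy T K"
    and P: "\<And>n. P (Suc n) = block_cond (T n) (B n) (\<delta> n) (K n) (P n)"
    and "P n ((f ^^ (q * T n)) x)" and "j < n" and q: "k * T j div T n = q"
    and top: "\<And>i. j < i \<Longrightarrow> i < n \<Longrightarrow> \<not> block_hierarchy.marked K i (k * T j div T i)"
  shows "\<bar>S (T j) ((f ^^ (k * T j)) x)\<bar> \<le> B j * T j \<and>
    (block_hierarchy.marked K j k \<longrightarrow> dense_orbit (\<delta> j) (T j) ((f ^^ (k * T j)) x))"
proof -
  interpret block_hierarchy T K by fact
  show ?thesis
    using assms(3-)
  proof (induction n arbitrary: q)
    case (Suc n)
    let ?q = "k * T j div T n"
    define r where "r = ?q mod K n"
    have "r < K n" using K_ge[of n] by (simp add: r_def)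
    have div: "?q div K n = q"
      using Suc.prems(3) by (simp add: T_Suc div_mult2_eq mult.commute[of "K n"])
    then have "?q = q * K n + r" unfolding r_def by (metis div_mult_mod_eq)
    then have q: "?q * T n = r * T n + q * T (Suc n)"
      by (simp add: T_Suc add_mult_distrib)
    have cond: "\<bar>S (T n) ((f ^^ (?q * T n)) x)\<bar> \<le> B n * T n"
        "if r = K n div 2 then dense_orbit (\<delta> n) (T n) ((f ^^ (?q * T n)) x) else P n ((f ^^ (?q * T n)) x)"
      using Suc.prems(1) \<open>r < K n\<close> unfolding P block_cond_def q funpow_add comp_apply by blast+
    show ?case
    proof (cases "j = n")
      case True
      then have "?q = k" using T_pos[of n] by simp
      with cond True show ?thesis unfolding r_def marked_def by (auto split: if_splits)
    next
      case False
      then have "j < n" using Suc.prems(2) by simp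
      then have "r \<noteq> K n div 2" using Suc.prems(4)[of n] by (auto simp: marked_def r_def)
      then have "P n ((f ^^ (?q * T n)) x)" using cond(2) by simp
      from Suc.IH[OF this \<open>j < n\<close> refl] Suc.prems(4) show ?thesis by simp
    qed
  qed simp
qed

text \<open>
  For every \<open>n\<close> the plaque contains a point that satisfies the requirement of level \<open>n\<close>. A limit
  point of these points inherits the bounds on the averages by continuity, and the density of
  orbit segments with twice the radius.
\<close>
lemma controlled_point:
  assumes f: "continuous_on UNIV f" and D: "D \<in> F" "compact D"
  shows "\<exists>x\<in>D. controlled_at_any_scale f \<phi> Y x"
proof -
  define B where "B n = 3 * C / 4 ^ n" for n :: nat
  define \<delta> where "\<delta> n = \<Delta> / (n + 1)" for n :: nat
  have "0 < \<Delta>" using diam[of undefined undefined] zero_le_dist by (rule le_less_trans[rotated])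
  then have \<delta>_pos: "0 < \<delta> n" for n by (simp add: \<delta>_def)
  obtain T K P where T0: "0 < T 0" "3 dvd T (0::nat)"
    and T: "\<forall>n. T (Suc n) = K n * T n \<and> 9 \<le> K n \<and> 2 ^ (n + 2) < K n \<and> n * K n \<le> K (Suc n) \<and>
        P (Suc n) = block_cond (T n) (3 * C / 4 ^ n) (\<Delta> / (n + 1)) (K n) (P n) \<and>
        (\<forall>D\<in>F. \<exists>x\<in>D. P n x)"
    using steering_hierarchy by blast
  have P: "P (Suc n) = block_cond (T n) (B n) (\<delta> n) (K n) (P n)" for n
    using T unfolding B_def \<delta>_def by blast
  have hier: "block_hierarchy T K" using T0 T by unfold_locales auto
  interpret block_hierarchy T K by fact
  have "\<forall>n. \<exists>x\<in>D. P n x" using T D(1) by blast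
  then obtain y where y: "\<And>n. y n \<in> D" "\<And>n. P n (y n)" by metis
  obtain x r where x: "x \<in> D" "strict_mono r" "(y \<circ> r) \<longlonglongrightarrow> x"
    using D(2) y(1) unfolding compact_def by metis
  have f_lim: "(\<lambda>n. (f ^^ i) (y (r n))) \<longlonglongrightarrow> (f ^^ i) x" for i
  proof (induction i)
    case 0
    then show ?case using x(3) by (simp add: o_def)
  next
    case (Suc i)
    then show ?case using continuous_on_tendsto_compose[OF f Suc] by simp
  qed
  have S_lim: "(\<lambda>n. S m ((f ^^ i) (y (r n)))) \<longlonglongrightarrow> S m ((f ^^ i) x)" for m i
    unfolding birkhoff_sum_def
  proof (rule tendsto_sum)
    fix l
    have "continuous_on UNIV \<phi>" using \<phi>_unif by (rule uniformly_continuous_imp_continuous)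
    from continuous_on_tendsto_compose[OF this f_lim[of "l + i"]]
    show "(\<lambda>n. \<phi> ((f ^^ l) ((f ^^ i) (y (r n))))) \<longlonglongrightarrow> \<phi> ((f ^^ l) ((f ^^ i) x))"
      by (simp add: funpow_add)
  qed
  have approx: "\<bar>S (T j) ((f ^^ (k * T j)) (y (r n)))\<bar> \<le> B j * T j \<and>
    (marked j k \<longrightarrow> dense_orbit (\<delta> j) (T j) ((f ^^ (k * T j)) (y (r n))))"
    if top: "unmarked_above j (k * T j)" and n: "n > j + k * T j" for j k n
  proof (rule block_cond_hierarchy[OF hier P, of "r n" 0])
    have "n \<le> r n" using x(2) by (rule seq_suble)
    then show "j < r n" using n by simp
    \<comment> \<open>Since \<open>i < T i\<close> for all \<open>i\<close>, the block lies in the first block of level \<open>r n\<close>.\<close>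
    have "k * T j < T (r n)" using n \<open>n \<le> r n\<close> T_gt[of "r n"] by linarith
    then show "k * T j div T (r n) = 0" by simp
    show "P (r n) ((f ^^ (0 * T (r n))) (y (r n)))" using y(2) by simp
    show "\<not> marked i (k * T j div T i)" if "j < i" for i
      using top that by (simp add: unmarked_above_def)
  qed
  have sum: "\<bar>S (T j) ((f ^^ (k * T j)) x)\<bar> \<le> B j * T j" if "unmarked_above j (k * T j)" for j k
  proof (rule LIMSEQ_le_const2)
    show "(\<lambda>n. \<bar>S (T j) ((f ^^ (k * T j)) (y (r n)))\<bar>) \<longlonglongrightarrow> \<bar>S (T j) ((f ^^ (k * T j)) x)\<bar>"
      using S_lim by (rule tendsto_rabs)
    show "\<exists>N. \<forall>n\<ge>N. \<bar>S (T j) ((f ^^ (k * T j)) (y (r n)))\<bar> \<le> B j * T j"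
      using approx[OF that] by (intro exI[of _ "Suc (j + k * T j)"]) auto
  qed
  have shift: "(\<lambda>i. (f ^^ i) x) ` block T n k = (\<lambda>i. (f ^^ i) ((f ^^ (k * T n)) x)) ` {..<T n}" for n k x
  proof -
    have "block T n k = (\<lambda>i. i + k * T n) ` {..<T n}"
      using T_pos[of n] image_add_atLeastLessThan'[of "k * T n" 0 "T n"]
      by (simp add: block_def lessThan_atLeast0 atLeastLessThanSuc_atLeastAtMost[symmetric] add.commute)
    then show ?thesis by (simp add: image_image funpow_add)
  qed
  have dense: "delta_dense (2 * \<delta> j) ((\<lambda>i. (f ^^ i) x) ` block T j k) Y"
    if "unmarked_above j (k * T j)" "marked j k" for j k
  proof -
    let ?z = "(f ^^ (k * T j)) x"
    have "\<forall>\<^sub>F n in sequentially. \<forall>i\<in>{..<T j}. dist ((f ^^ (i + k * T j)) (y (r n))) ((f ^^ (i + k * T j)) x) < \<delta> j"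
      using f_lim \<delta>_pos by (intro eventually_ball_finite ballI tendstoD) auto
    then have "\<forall>\<^sub>F n in sequentially. j + k * T j < n \<and>
        (\<forall>i\<in>{..<T j}. dist ((f ^^ (i + k * T j)) (y (r n))) ((f ^^ (i + k * T j)) x) < \<delta> j)"
      by (intro eventually_conj eventually_gt_at_top)
    then obtain n where n: "j + k * T j < n"
        "\<forall>i\<in>{..<T j}. dist ((f ^^ (i + k * T j)) (y (r n))) ((f ^^ (i + k * T j)) x) < \<delta> j"
      using eventually_happens'[OF sequentially_bot] by blast
    have "dense_orbit (\<delta> j) (T j) ((f ^^ (k * T j)) (y (r n)))"
      using approx[OF that(1) n(1)] that(2) by blast
    then have near: "\<exists>i\<in>{..<T j}. dist ((f ^^ (i + k * T j)) (y (r n))) p < \<delta> j" if "p \<in> Y" for p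
      using that unfolding dense_orbit_def delta_dense_def by (auto simp: funpow_add subset_iff)
    have "p \<in> (\<Union>s\<in>(\<lambda>i. (f ^^ i) ?z) ` {..<T j}. ball s (2 * \<delta> j))" if "p \<in> Y" for p
    proof -
      obtain i where i: "i \<in> {..<T j}" "dist ((f ^^ (i + k * T j)) (y (r n))) p < \<delta> j"
        using near[OF \<open>p \<in> Y\<close>] by blast
      have "dist ((f ^^ (i + k * T j)) x) p < 2 * \<delta> j"
        using n(2)[rule_format, OF i(1)] i(2)
          dist_triangle3[of "(f ^^ (i + k * T j)) x" p "(f ^^ (i + k * T j)) (y (r n))"] by linarith
      then show ?thesis using i(1) by (auto simp: funpow_add)
    qed
    then show ?thesis unfolding delta_dense_def shift by blast
  qed
  have "controlled_at_any_scale f \<phi> Y x"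
    unfolding controlled_at_any_scale_def
  proof (rule exI[of _ T], rule exI[of _ "\<lambda>n. (1 / 2) ^ Suc n"], rule exI[of _ tail],
      rule exI[of _ "\<lambda>n. 2 * \<delta> n"], rule exI[of _ B], intro conjI allI impI)
    show "scale T" using T0(2) T by (intro scale_T) auto
    show "controlling_sequence (\<lambda>n. (1 / 2) ^ Suc n)" by (rule controlling_sequence_geometric)
    show "long_sparse_tail T (\<lambda>n. (1 / 2) ^ Suc n) tail"
    proof (rule long_sparse_tail_tail)
      fix n
      have "real (2 ^ (n + 2)) < real (K n)" using T by (simp only: of_nat_less_iff)
      then show "1 / real (K n) < (1 / 2) ^ Suc (Suc n)"
        using K_ge[of n] by (simp add: power_one_over divide_less_eq less_divide_eq)
    qed
    show "decseq (\<lambda>n. 2 * \<delta> n)"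
      using \<open>0 < \<Delta>\<close> by (intro decseq_SucI) (simp add: \<delta>_def field_simps)
    show "0 < 2 * \<delta> n" for n using \<delta>_pos by simp
    show "(\<lambda>n. 2 * \<delta> n) \<longlonglongrightarrow> 0"
      unfolding \<delta>_def using tendsto_mult_right_zero[OF LIMSEQ_inverse_real_of_nat, of "2 * \<Delta>"]
      by (simp add: field_simps)
    show "decseq B" using C_pos by (intro decseq_SucI) (simp add: B_def field_simps)
    show "0 < B n" for n using C_pos by (simp add: B_def)
    show "B \<longlonglongrightarrow> 0"
      unfolding B_def using tendsto_mult_right_zero[OF LIMSEQ_inverse_realpow_zero[of 4], of "3 * C"]
      by (simp add: field_simps)
    show "delta_dense (2 * \<delta> n) ((\<lambda>i. (f ^^ i) x) ` I) Y"
      if I: "nat_component tail I \<and> card I = T n" for n I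
    proof -
      obtain m k where m: "I = block T m k" "marked m k" "unmarked_above m (k * T m)"
        using component_is_block I by blast
      then have "m = n" using I card_block[of m k] strict_mono_eq[OF strict_mono_T] by simp
      then show ?thesis using dense m by blast
    qed
    show "(\<Sum>i\<in>block T n k. \<phi> ((f ^^ i) x)) / real (T n) \<in> {- B n..B n}"
      if "\<not> block T n k \<subseteq> tail_from T tail (n + 1)" for n k
    proof -
      have "(\<Sum>i\<in>block T n k. \<phi> ((f ^^ i) x)) = S (T n) ((f ^^ (k * T n)) x)"
      proof -
        have "block T n k = {0 + k * T n..<T n + k * T n}"
          using T_pos[of n] by (auto simp: block_def)
        then show ?thesis
          unfolding birkhoff_sum_def lessThan_atLeast0
          by (simp only: sum.shift_bounds_nat_ivl funpow_add comp_apply)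
      qed
      moreover have "\<bar>S (T n) ((f ^^ (k * T n)) x)\<bar> \<le> B n * T n"
        by (rule sum[OF unmarked_above_if_not_tail_from[OF that]])
      ultimately show ?thesis using T_pos[of n] by (auto simp: abs_le_iff field_simps)
    qed
  qed
  with x(1) show ?thesis by blast
qed

end

theorem theorem2:
  fixes f :: "'a::metric_space \<Rightarrow> 'a"
    and \<phi> :: "'a \<Rightarrow> real"
    and Y :: "'a set"
    and Fp Fm :: "'a set set"
  assumes "compact (UNIV :: 'a set)"
    and "compact Y"
    and "\<exists>g. homeomorphism UNIV UNIV f g"
    and "continuous_on UNIV \<phi>"
    and "flip_flop_family \<phi> f Fp Fm"
    and "has_sojourns f Fp Fm Y"
  shows "\<forall>D\<in>Fp \<union> Fm. \<exists>x\<in>D. controlled_at_any_scale f \<phi> Y x"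
proof
  fix D assume D: "D \<in> Fp \<union> Fm"
  have f: "continuous_on UNIV f" using assms(3) by (auto simp: homeomorphism_def)
  have plaque: "compact E" "E \<noteq> {}" if "E \<in> Fp \<union> Fm" for E
  proof -
    have "\<forall>D\<in>Fp \<union> Fm. compact D \<and> D \<noteq> {}"
      using assms(5) unfolding flip_flop_family_def by (elim conjE)
    then show "compact E" "E \<noteq> {}" using that by blast+
  qed
  obtain \<alpha> \<zeta>1 where \<alpha>: "0 < \<alpha>" and \<zeta>1: "\<forall>n. 0 < \<zeta>1 n" "\<zeta>1 \<longlonglongrightarrow> 0"
    and pos: "\<forall>D\<in>Fp. \<forall>x\<in>D. \<phi> x \<ge> \<alpha>" and neg: "\<forall>D\<in>Fm. \<forall>x\<in>D. \<phi> x \<le> - \<alpha>"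
    and succ: "\<forall>D\<in>Fp \<union> Fm. (\<exists>D'\<in>Fp. D' \<subseteq> f ` D) \<and> (\<exists>D'\<in>Fm. D' \<subseteq> f ` D)"
    and contr: "\<forall>n>0. \<forall>D::nat \<Rightarrow> 'a set.
           (\<forall>i\<le>n. D i \<in> Fp \<union> Fm) \<and> (\<forall>i<n. D (Suc i) \<subseteq> f ` D i) \<longrightarrow>
           (\<forall>i\<le>n. \<forall>x \<in> (f ^^ n) -` D n. \<forall>y \<in> (f ^^ n) -` D n.
              dist ((f ^^ (n - i)) x) ((f ^^ (n - i)) y)
                \<le> \<zeta>1 i * dist ((f ^^ n) x) ((f ^^ n) y))"
    using assms(5) unfolding flip_flop_family_def by (elim conjE exE) (rule that; assumption)
  obtain \<zeta>2 where \<zeta>2: "\<forall>n. 0 < \<zeta>2 n" "\<zeta>2 \<longlonglongrightarrow> 0"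
    and soj: "\<forall>\<delta>>0. \<exists>N::nat. \<forall>D\<in>Fp \<union> Fm. \<exists>Dp Dm.
          Dp \<subseteq> D \<and> Dm \<subseteq> D \<and>
          (\<forall>x\<in>Dp \<union> Dm. delta_dense \<delta> ((\<lambda>i. (f ^^ i) x) ` {0..N}) Y) \<and>
          (f ^^ N) ` Dp \<in> Fp \<and> (f ^^ N) ` Dm \<in> Fm \<and>
          (\<forall>i\<le>N. \<forall>x y. (x \<in> Dp \<and> y \<in> Dp) \<or> (x \<in> Dm \<and> y \<in> Dm) \<longrightarrow>
             dist ((f ^^ (N - i)) x) ((f ^^ (N - i)) y)
               \<le> \<zeta>2 i * dist ((f ^^ N) x) ((f ^^ N) y))"
    using assms(6) unfolding has_sojourns_def by (elim conjE exE) (rule that; assumption)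
  define \<zeta> where "\<zeta> n = max (\<zeta>1 n) (\<zeta>2 n)" for n
  have \<zeta>: "\<zeta> \<longlonglongrightarrow> 0"
    unfolding \<zeta>_def using tendsto_max[OF \<zeta>1(2) \<zeta>2(2)] by simp
  have le: "\<zeta>1 n * d \<le> \<zeta> n * d" "\<zeta>2 n * d \<le> \<zeta> n * d" if "0 \<le> d" for n d
    using that by (auto simp: \<zeta>_def intro!: mult_right_mono)
  have "Bseq \<zeta>" using \<zeta> by (intro convergent_imp_Bseq convergentI)
  then obtain Z0 where Z0: "\<And>n. \<bar>\<zeta> n\<bar> \<le> Z0" by (auto simp: Bseq_def)
  define Z where "Z = max 1 Z0"
  have Z: "1 \<le> Z" "\<zeta> n \<le> Z" for n using Z0[of n] by (auto simp: Z_def)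
  obtain C0 where C0: "\<And>x. \<bar>\<phi> x\<bar> \<le> C0"
    using compact_imp_bounded[OF compact_continuous_image[OF assms(4,1)]]
    by (auto simp: bounded_iff)
  define C where "C = max \<alpha> C0"
  have C: "\<bar>\<phi> x\<bar> \<le> C" for x using C0[of x] by (simp add: C_def)
  have "\<exists>\<Delta>. \<forall>x y::'a. dist x y < \<Delta>"
  proof -
    have "bounded (UNIV :: 'a set)" using assms(1) by (rule compact_imp_bounded)
    then obtain e where e: "\<forall>x y::'a. dist x y \<le> e" unfolding bounded_two_points by auto
    have "dist x y < e + 1" for x y :: 'a using e[rule_format, of x y] by linarith
    then show ?thesis by blast
  qed
  then obtain \<Delta> where \<Delta>: "\<And>x y::'a. dist x y < \<Delta>" by blast
  interpret flip_flop_sojourns f \<phi> Fp Fm Z C \<Delta> Y \<alpha> \<zeta>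
  proof
    show "1 \<le> Z * Z" using Z(1) mult_mono[of 1 Z 1 Z] by simp
    show "0 < C" "\<alpha> \<le> C" using \<alpha> by (auto simp: C_def)
    show "uniformly_continuous_on UNIV \<phi>"
      using assms(4,1) by (rule compact_uniformly_continuous)
    show "\<alpha> \<le> \<phi> x" if "D \<in> Fp" "x \<in> D" for D x using pos that by blast
    show "\<phi> x \<le> - \<alpha>" if "D \<in> Fm" "x \<in> D" for D x using neg that by blast
    show "(\<exists>D'\<in>Fp. D' \<subseteq> f ` D) \<and> (\<exists>D'\<in>Fm. D' \<subseteq> f ` D)" if "D \<in> Fp \<union> Fm" for D
      using succ that by blast
    show "dist ((f ^^ (n - i)) x) ((f ^^ (n - i)) y) \<le> \<zeta> i * dist ((f ^^ n) x) ((f ^^ n) y)"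
      if "0 < n" "\<forall>i\<le>n. E i \<in> Fp \<union> Fm" "\<forall>i<n. E (Suc i) \<subseteq> f ` E i" "i \<le> n"
        "(f ^^ n) x \<in> E n" "(f ^^ n) y \<in> E n" for n i x y and E :: "nat \<Rightarrow> 'a set"
    proof -
      have "dist ((f ^^ (n - i)) x) ((f ^^ (n - i)) y) \<le> \<zeta>1 i * dist ((f ^^ n) x) ((f ^^ n) y)"
        using contr that by blast
      also note le(1)[OF zero_le_dist]
      finally show ?thesis .
    qed
    show "\<exists>N. \<forall>D\<in>Fp \<union> Fm. \<exists>A\<subseteq>D. (f ^^ N) ` A \<in> Fp \<union> Fm \<and>
        (\<forall>x\<in>A. delta_dense \<delta> ((\<lambda>i. (f ^^ i) x) ` {0..N}) Y) \<and>
        (\<forall>x\<in>A. \<forall>y\<in>A. \<forall>i\<le>N. dist ((f ^^ (N - i)) x) ((f ^^ (N - i)) y)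
           \<le> \<zeta> i * dist ((f ^^ N) x) ((f ^^ N) y))" if "0 < \<delta>" for \<delta>
    proof -
      obtain N where N: "\<forall>D\<in>Fp \<union> Fm. \<exists>Dp Dm.
          Dp \<subseteq> D \<and> Dm \<subseteq> D \<and>
          (\<forall>x\<in>Dp \<union> Dm. delta_dense \<delta> ((\<lambda>i. (f ^^ i) x) ` {0..N}) Y) \<and>
          (f ^^ N) ` Dp \<in> Fp \<and> (f ^^ N) ` Dm \<in> Fm \<and>
          (\<forall>i\<le>N. \<forall>x y. (x \<in> Dp \<and> y \<in> Dp) \<or> (x \<in> Dm \<and> y \<in> Dm) \<longrightarrow>
             dist ((f ^^ (N - i)) x) ((f ^^ (N - i)) y)
               \<le> \<zeta>2 i * dist ((f ^^ N) x) ((f ^^ N) y))"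
        using soj[THEN spec, THEN mp, OF \<open>0 < \<delta>\<close>] by (elim exE) (rule that)
      show ?thesis
      proof (intro exI[of _ N] ballI)
        fix D assume "D \<in> Fp \<union> Fm"
        from bspec[OF N this] obtain A where A: "A \<subseteq> D" "(f ^^ N) ` A \<in> Fp"
            "\<forall>x\<in>A. delta_dense \<delta> ((\<lambda>i. (f ^^ i) x) ` {0..N}) Y"
            "\<forall>i\<le>N. \<forall>x y. x \<in> A \<and> y \<in> A \<longrightarrow> dist ((f ^^ (N - i)) x) ((f ^^ (N - i)) y)
               \<le> \<zeta>2 i * dist ((f ^^ N) x) ((f ^^ N) y)"
          by blast
        have "dist ((f ^^ (N - i)) x) ((f ^^ (N - i)) y) \<le> \<zeta> i * dist ((f ^^ N) x) ((f ^^ N) y)"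
          if "x \<in> A" "y \<in> A" "i \<le> N" for x y i
          using A(4) that le(2)[OF zero_le_dist] by (meson order_trans)
        then have "\<forall>x\<in>A. \<forall>y\<in>A. \<forall>i\<le>N. dist ((f ^^ (N - i)) x) ((f ^^ (N - i)) y)
           \<le> \<zeta> i * dist ((f ^^ N) x) ((f ^^ N) y)" by simp
        with A(1-3) show "\<exists>A\<subseteq>D. (f ^^ N) ` A \<in> Fp \<union> Fm \<and>
            (\<forall>x\<in>A. delta_dense \<delta> ((\<lambda>i. (f ^^ i) x) ` {0..N}) Y) \<and>
            (\<forall>x\<in>A. \<forall>y\<in>A. \<forall>i\<le>N. dist ((f ^^ (N - i)) x) ((f ^^ (N - i)) y)
               \<le> \<zeta> i * dist ((f ^^ N) x) ((f ^^ N) y))"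
          by (intro exI[of _ A] conjI UnI1)
      qed
    qed
  qed (use Z C \<Delta> \<zeta> \<alpha> plaque in auto)
  show "\<exists>x\<in>D. controlled_at_any_scale f \<phi> Y x"
    using controlled_point[OF f D plaque(1)[OF D]] .
qed

end
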